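(* Let $l\ge 2$. For any double-wedge pattern $\tau\in S_{2l}$ avoiding $132$, $$I_\tau(x)=I_{12\dots(2l)}(x)=\frac{R_l(x^2)}{1-x\,R_l(x^2)},$$ where for a pattern $\rho$, $I_\rho(x)=\sum_{n\ge 0}I_\rho(n)x^n$ and $I_\rho(n)$ is the number of involutions in $S_n$ avoiding both $132$ and $\rho$.
   Context: $S_n$ is the set of permutations of $\{1,\dots,n\}$, written in one-line notation. A permutation $\alpha\in S_n$ contains a pattern $\tau\in S_k$ if there are $1\le i_1<\dots<i_k\le n$ such that $(\alpha_{i_1},\dots,\alpha_{i_k})$ is order-isomorphic to $\tau$; otherwise it avoids $\tau$. An involution is a permutation equal to its own inverse; the empty permutation is counted for $n=0$. A permutation $\sigma\in S_m$ ($m\ge1$) is a wedge pattern if it can be written as a concatenation $\sigma=(\tau^1,\rho^1,\dots,\tau^r,\rho^r)$ such that each $\tau^i$ is nonempty, $(\tau^1,\tau^2,\dots,\tau^r)=(s+1,s+2,\dots,m)$ for some $s\ge 0$, and $(\rho^1,\dots,\rho^r)$ is a layered permutation of $1,\dots,s$ with layers $\rho^1,\dots,\rho^r$; that is, each $\rho^i$ is a (possibly empty) increasing sequence of consecutive integers and every entry of $\rho^i$ is larger than every entry of $\rho^{i'}$ whenever $i<i'$. For example $645783912$ and $456378129$ are wedge patterns. For a sequence $\sigma$, $\sigma+l$ denotes the sequence obtained by adding $l$ to every entry. A permutation $\tau\in S_{2l}$ is a double-wedge pattern if there is a wedge pattern $\sigma\in S_{l-1}$ such that $\tau=(\sigma^{-1}+l,\,2l,\,\sigma,\,l)$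 or $\tau=(\sigma+l,\,2l,\,\sigma^{-1},\,l)$. $U_r$ is the Chebyshev polynomial of the second kind, $U_r(\cos\theta)=\sin((r+1)\theta)/\sin\theta$, and for $k\ge1$, $R_k(x)=\dfrac{2t\,U_{k-1}(t)}{U_k(t)}$ with $t=\dfrac{1}{2\sqrt{x}}$ (a rational function of $x$). *)

theory Defs
  imports
    "HOL-Analysis.Analysis"
    "HOL-Library.Sublist"
    "HOL-Computational_Algebra.Computational_Algebra"
    "HOL-Combinatorics.Combinatorics"
begin

section \<open>Permutations and patterns\<close>

definition one_line :: "nat \<Rightarrow> (nat \<Rightarrow> nat) \<Rightarrow> nat list" where
  "one_line n \<pi> = map \<pi> [1..<Suc n]"

definition order_isomorphic :: "nat list \<Rightarrow> nat list \<Rightarrow> bool" where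
  "order_isomorphic xs ys \<longleftrightarrow>
     length xs = length ys \<and>
     (\<forall>i<length xs. \<forall>j<length xs. xs ! i < xs ! j \<longleftrightarrow> ys ! i < ys ! j)"

text \<open>Words and patterns are both given in one-line notation.\<close>

definition contains_pattern :: "nat list \<Rightarrow> nat list \<Rightarrow> bool" where
  "contains_pattern \<alpha> \<rho> \<longleftrightarrow> (\<exists>\<beta>. subseq \<beta> \<alpha> \<and> order_isomorphic \<beta> \<rho>)"

definition avoids_pattern :: "nat list \<Rightarrow> nat list \<Rightarrow> bool" where
  "avoids_pattern \<alpha> \<rho> \<longleftrightarrow> \<not> contains_pattern \<alpha> \<rho>"

definition avoiding_involutions :: "nat list \<Rightarrow> nat \<Rightarrow> (nat \<Rightarrow> nat) set" where
  "avoiding_involutions \<rho> n =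
     {\<pi>. \<pi> permutes {1..n} \<and> inv \<pi> = \<pi> \<and>
          avoids_pattern (one_line n \<pi>) [1, 3, 2] \<and> avoids_pattern (one_line n \<pi>) \<rho>}"

definition involution_gf :: "nat list \<Rightarrow> real fps" where
  "involution_gf \<rho> = Abs_fps (\<lambda>n. of_nat (card (avoiding_involutions \<rho> n)))"


section \<open>Wedge and double-wedge patterns\<close>

text \<open>
  The layers are listed from left to right and may be empty; \<open>[a..<b]\<close> is the
  increasing run of consecutive integers \<open>a, \<dots>, b - 1\<close>.
\<close>

definition layered_with :: "nat \<Rightarrow> nat list list \<Rightarrow> bool" where
  "layered_with s \<rho>s \<longleftrightarrow>
     concat \<rho>s \<in> permutations_of_set {1..s} \<and>
     (\<forall>\<rho>\<in>set \<rho>s. \<exists>a b. \<rho> = [a..<b]) \<and>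
     (\<forall>i' < length \<rho>s. \<forall>i < i'. \<forall>x\<in>set (\<rho>s ! i). \<forall>y\<in>set (\<rho>s ! i'). y < x)"

definition wedge_word :: "nat \<Rightarrow> nat list \<Rightarrow> bool" where
  "wedge_word m w \<longleftrightarrow>
     (\<exists>\<tau>s \<rho>s s. length \<tau>s = length \<rho>s \<and>
        w = concat (map2 (\<lambda>\<tau> \<rho>. \<tau> @ \<rho>) \<tau>s \<rho>s) \<and>
        (\<forall>\<tau>\<in>set \<tau>s. \<tau> \<noteq> []) \<and>
        concat \<tau>s = [Suc s..<Suc m] \<and>
        layered_with s \<rho>s)"

definition wedge_pattern :: "nat \<Rightarrow> (nat \<Rightarrow> nat) \<Rightarrow> bool" where
  "wedge_pattern m \<sigma> \<longleftrightarrow> 1 \<le> m \<and> \<sigma> permutes {1..m} \<and> wedge_word m (one_line m \<sigma>)"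

definition double_wedge_pattern :: "nat \<Rightarrow> (nat \<Rightarrow> nat) \<Rightarrow> bool" where
  "double_wedge_pattern l \<tau> \<longleftrightarrow>
     \<tau> permutes {1..2 * l} \<and>
     (\<exists>\<sigma>. wedge_pattern (l - 1) \<sigma> \<and>
        (one_line (2 * l) \<tau> =
           map (\<lambda>x. x + l) (one_line (l - 1) (inv \<sigma>)) @ [2 * l] @ one_line (l - 1) \<sigma> @ [l] \<or>
         one_line (2 * l) \<tau> =
           map (\<lambda>x. x + l) (one_line (l - 1) \<sigma>) @ [2 * l] @ one_line (l - 1) (inv \<sigma>) @ [l]))"


section \<open>Chebyshev polynomials of the second kind\<close>

text \<open>The description determines the polynomial: see \<open>chebyshev_U_unique\<close> and
  \<open>chebyshev_U_cos\<close> below.\<close>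

definition chebyshev_U :: "nat \<Rightarrow> real poly" where
  "chebyshev_U r =
     (THE p. \<forall>\<theta>. sin \<theta> \<noteq> 0 \<longrightarrow> poly p (cos \<theta>) = sin (real (r + 1) * \<theta>) / sin \<theta>)"

text \<open>
  The function \<open>R\<^sub>k(x) = 2 t U\<^sub>k\<^sub>-\<^sub>1(t) / U\<^sub>k(t)\<close> with \<open>t = 1 / (2 \<surd>x)\<close> is a rational
  function of \<open>x\<close> that is regular at \<open>0\<close>, and is represented by its power series in \<open>x\<close>.
  The defining equation is read in the field of formal Laurent series in \<open>\<surd>x\<close>: there the
  variable \<open>fls_X\<close> stands for \<open>\<surd>x\<close>, so that \<open>x\<close> is the square of the variable.
  Existence and uniqueness are proved in \<open>chebyshev_R_eq\<close> and \<open>chebyshev_R_unique\<close>;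
  \<open>chebyshev_R_rational\<close> relates the series to the real function of \<open>x > 0\<close>.
\<close>

definition chebyshev_U_fls :: "nat \<Rightarrow> real fls \<Rightarrow> real fls" where
  "chebyshev_U_fls k t = poly (map_poly fls_const (chebyshev_U k)) t"

definition chebyshev_R :: "nat \<Rightarrow> real fps" where
  "chebyshev_R k =
     (THE F. let t = 1 / (2 * fls_X) in
        fps_to_fls (F oo fps_X\<^sup>2) = 2 * t * chebyshev_U_fls (k - 1) t / chebyshev_U_fls k t)"


subsection \<open>The definitions describe unique objects\<close>

fun chebyshev_rec :: "nat \<Rightarrow> real poly" where
  "chebyshev_rec 0 = 1"
| "chebyshev_rec (Suc 0) = [:0, 2:]"
| "chebyshev_rec (Suc (Suc n)) = pCons 0 (smult 2 (chebyshev_rec (Suc n))) - chebyshev_rec n"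

lemma chebyshev_rec_sin:
  "poly (chebyshev_rec n) (cos \<theta>) * sin \<theta> = sin (real (n + 1) * \<theta>)"
proof (induction n rule: chebyshev_rec.induct)
  case 1
  show ?case by simp
next
  case 2
  show ?case using sin_double[of \<theta>] by (simp add: mult_ac)
next
  case (3 n)
  have a: "sin (real (n + 3) * \<theta>) + sin (real (n + 1) * \<theta>) = 2 * cos \<theta> * sin (real (n + 2) * \<theta>)"
  proof -
    have "sin (real (n + 3) * \<theta>) = sin (real (n + 2) * \<theta> + \<theta>)"
      and "sin (real (n + 1) * \<theta>) = sin (real (n + 2) * \<theta> - \<theta>)"
      by (simp_all add: algebra_simps)
    then show ?thesis by (simp only: sin_add sin_diff) (simp add: algebra_simps)
  qed
  have "poly (chebyshev_rec (Suc (Suc n))) (cos \<theta>) * sin \<theta> =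
      2 * cos \<theta> * (poly (chebyshev_rec (Suc n)) (cos \<theta>) * sin \<theta>)
      - poly (chebyshev_rec n) (cos \<theta>) * sin \<theta>"
    by (simp add: algebra_simps)
  also have "\<dots> = sin (real (n + 3) * \<theta>)"
    using a 3 by (simp add: algebra_simps)
  finally show ?case by (simp add: eval_nat_numeral)
qed

lemma chebyshev_U_unique:
  fixes p q :: "real poly"
  assumes "\<And>\<theta>. sin \<theta> \<noteq> 0 \<Longrightarrow> poly p (cos \<theta>) = sin (real (r + 1) * \<theta>) / sin \<theta>"
    and "\<And>\<theta>. sin \<theta> \<noteq> 0 \<Longrightarrow> poly q (cos \<theta>) = sin (real (r + 1) * \<theta>) / sin \<theta>"
  shows "p = q"
proof (rule ccontr)
  assume "p \<noteq> q"
  then have fin: "finite {x. poly (p - q) x = 0}"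
    by (intro poly_roots_finite) simp
  have "poly (p - q) x = 0" if "x \<in> {-1<..<1}" for x
  proof -
    have "sin (arccos x) \<noteq> 0" "cos (arccos x) = x"
      using that by (auto simp: sin_arccos_nonzero)
    then show ?thesis using assms[of "arccos x"] by simp
  qed
  then have "{-1<..<1} \<subseteq> {x. poly (p - q) x = 0}" by blast
  with fin have "finite {-1<..<(1::real)}" by (rule rev_finite_subset)
  then show False by (simp add: infinite_Ioo)
qed

lemma chebyshev_U_eq_rec: "chebyshev_U r = chebyshev_rec r"
proof -
  have e: "poly (chebyshev_rec r) (cos \<theta>) = sin (real (r + 1) * \<theta>) / sin \<theta>"
    if "sin \<theta> \<noteq> 0" for \<theta>
    using chebyshev_rec_sin[of r \<theta>] that by (simp add: field_simps)
  show ?thesis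
    unfolding chebyshev_U_def
  proof (rule the_equality)
    show "\<forall>\<theta>. sin \<theta> \<noteq> 0 \<longrightarrow>
        poly (chebyshev_rec r) (cos \<theta>) = sin (real (r + 1) * \<theta>) / sin \<theta>"
      using e by blast
  next
    fix p :: "real poly"
    assume "\<forall>\<theta>. sin \<theta> \<noteq> 0 \<longrightarrow> poly p (cos \<theta>) = sin (real (r + 1) * \<theta>) / sin \<theta>"
    then show "p = chebyshev_rec r" using e by (intro chebyshev_U_unique) auto
  qed
qed

lemma chebyshev_U_cos:
  "sin \<theta> \<noteq> 0 \<Longrightarrow> poly (chebyshev_U r) (cos \<theta>) = sin (real (r + 1) * \<theta>) / sin \<theta>"
  using chebyshev_rec_sin[of r \<theta>] by (simp add: chebyshev_U_eq_rec field_simps)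

text \<open>Numerators and denominators of \<open>R\<^sub>k\<close>: \<open>U\<^sub>k(1 / (2 y)) = y\<^sup>-\<^sup>k P\<^sub>k(y\<^sup>2)\<close>.\<close>

fun chebyshev_P :: "nat \<Rightarrow> real poly" where
  "chebyshev_P 0 = 1"
| "chebyshev_P (Suc 0) = 1"
| "chebyshev_P (Suc (Suc n)) = chebyshev_P (Suc n) - pCons 0 (chebyshev_P n)"

lemma poly_chebyshev_P_0: "poly (chebyshev_P n) 0 = 1"
  by (induction n rule: chebyshev_P.induct) simp_all

lemma chebyshev_U_P_real:
  fixes y :: real
  assumes "y \<noteq> 0"
  shows "poly (chebyshev_U k) (1 / (2 * y)) * y ^ k = poly (chebyshev_P k) (y\<^sup>2)"
  unfolding chebyshev_U_eq_rec
proof (induction k rule: chebyshev_P.induct)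
  case (3 n)
  have "poly (chebyshev_rec (Suc (Suc n))) (1 / (2 * y)) * y ^ Suc (Suc n) =
      poly (chebyshev_rec (Suc n)) (1 / (2 * y)) * y ^ Suc n
      - y\<^sup>2 * (poly (chebyshev_rec n) (1 / (2 * y)) * y ^ n)"
    using assms by (simp add: field_simps power2_eq_square)
  then show ?case using 3 by simp
qed (use assms in simp_all)

lemma poly_map_fls_const_add:
  "poly (map_poly fls_const (p + q)) t = poly (map_poly fls_const p) t + poly (map_poly fls_const q) t"
  for p q :: "real poly"
proof -
  have "map_poly fls_const (p + q) = map_poly fls_const p + map_poly fls_const q"
    by (intro poly_eqI) (simp add: coeff_map_poly fls_plus_const)
  then show ?thesis by simp
qed

lemma poly_map_fls_const_diff:
  "poly (map_poly fls_const (p - q)) t = poly (map_poly fls_const p) t - poly (map_poly fls_const q) t"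
  for p q :: "real poly"
  using poly_map_fls_const_add[of "p - q" q t] by simp

lemma poly_map_fls_const_smult:
  "poly (map_poly fls_const (smult c p)) t = fls_const c * poly (map_poly fls_const p) t"
  for p :: "real poly"
proof -
  have "map_poly fls_const (smult c p) = smult (fls_const c) (map_poly fls_const p)"
    by (intro poly_eqI) (simp add: coeff_map_poly fls_const_mult_const)
  then show ?thesis by simp
qed

lemma chebyshev_U_P_fls:
  fixes y :: "real fls"
  assumes "y \<noteq> 0"
  shows "chebyshev_U_fls k (1 / (2 * y)) * y ^ k = poly (map_poly fls_const (chebyshev_P k)) (y\<^sup>2)"
  unfolding chebyshev_U_fls_def chebyshev_U_eq_rec
proof (induction k rule: chebyshev_P.induct)
  case 1
  show ?case by (simp add: map_poly_pCons flip: one_pCons)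
next
  case 2
  show ?case using assms by (simp add: map_poly_pCons flip: one_pCons)
next
  case (3 n)
  let ?e = "\<lambda>p. poly (map_poly fls_const p) (1 / (2 * y))"
  have "?e (chebyshev_rec (Suc (Suc n))) =
      1 / (2 * y) * (2 * ?e (chebyshev_rec (Suc n))) - ?e (chebyshev_rec n)"
    by (simp add: poly_map_fls_const_diff poly_map_fls_const_smult map_poly_pCons)
  then have "?e (chebyshev_rec (Suc (Suc n))) * y ^ Suc (Suc n) =
      ?e (chebyshev_rec (Suc n)) * y ^ Suc n - y\<^sup>2 * (?e (chebyshev_rec n) * y ^ n)"
    by (simp only:) (use assms in \<open>simp add: field_simps power2_eq_square\<close>)
  then show ?case
    using 3 by (simp add: poly_map_fls_const_diff map_poly_pCons)
qed

lemma fps_to_fls_of_poly_compose: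
  "fps_to_fls (fps_of_poly p oo fps_X\<^sup>2) = poly (map_poly fls_const p) ((fls_X :: real fls)\<^sup>2)"
proof (induction p)
  case 0
  show ?case by simp
next
  case (pCons a p)
  have "fps_of_poly (pCons a p) oo fps_X\<^sup>2 =
      fps_const a + (fps_X :: real fps)\<^sup>2 * (fps_of_poly p oo fps_X\<^sup>2)"
    by (simp add: fps_of_poly_pCons fps_compose_add_distrib fps_compose_mult_distrib mult.commute)
  then show ?case
    using pCons by (simp add: map_poly_pCons fls_times_fps_to_fls fps_to_fls_power)
qed

lemma chebyshev_R_witness:
  assumes "1 \<le> k"
  defines "F \<equiv> fps_of_poly (chebyshev_P (k - 1)) / fps_of_poly (chebyshev_P k)"
    and "t \<equiv> 1 / (2 * fls_X) :: real fls"
  shows "fps_to_fls (F oo fps_X\<^sup>2) = 2 * t * chebyshev_U_fls (k - 1) t / chebyshev_U_fls k t"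
proof -
  let ?N = "fps_of_poly (chebyshev_P (k - 1))" and ?D = "fps_of_poly (chebyshev_P k)"
  have D0: "?D $ 0 = 1"
    using poly_chebyshev_P_0[of k] by (simp add: poly_0_coeff_0)
  then have "F * ?D = ?N"
    unfolding F_def by (simp add: fps_divide_unit mult.assoc inverse_mult_eq_1)
  then have "(F oo fps_X\<^sup>2) * (?D oo fps_X\<^sup>2) = ?N oo fps_X\<^sup>2"
    by (simp flip: fps_compose_mult_distrib)
  then have eq: "fps_to_fls (F oo fps_X\<^sup>2) * fps_to_fls (?D oo fps_X\<^sup>2) = fps_to_fls (?N oo fps_X\<^sup>2)"
    by (simp flip: fls_times_fps_to_fls)
  have "(?D oo fps_X\<^sup>2) $ 0 = 1" using D0 by simp
  then have "?D oo fps_X\<^sup>2 \<noteq> 0" by (intro notI) simp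
  then have Dn: "fps_to_fls (?D oo fps_X\<^sup>2) \<noteq> 0" by (simp only: fps_to_fls_eq_0_iff not_False_eq_True)
  have X: "(fls_X :: real fls) \<noteq> 0" by simp
  have UD: "chebyshev_U_fls k t * fls_X ^ k = fps_to_fls (?D oo fps_X\<^sup>2)"
    and UN: "chebyshev_U_fls (k - 1) t * fls_X ^ (k - 1) = fps_to_fls (?N oo fps_X\<^sup>2)"
    unfolding t_def by (simp_all only: fps_to_fls_of_poly_compose chebyshev_U_P_fls[OF X])
  have Un: "chebyshev_U_fls k t \<noteq> 0" using UD Dn by auto
  have "2 * (1 / (2 * y)) * y = 1" if "y \<noteq> 0" for y :: "real fls"
    using that by simp
  from this[OF X] have tX: "2 * t * fls_X = 1" unfolding t_def .
  have "(fls_X :: real fls) ^ k = fls_X * fls_X ^ (k - 1)"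
    using assms(1) by (cases k) simp_all
  then have "fps_to_fls (F oo fps_X\<^sup>2) * (chebyshev_U_fls k t * fls_X) * fls_X ^ (k - 1) =
      chebyshev_U_fls (k - 1) t * fls_X ^ (k - 1)"
    using eq unfolding UD[symmetric] UN[symmetric] by (simp only: mult_ac)
  then have "fps_to_fls (F oo fps_X\<^sup>2) * (chebyshev_U_fls k t * fls_X) = chebyshev_U_fls (k - 1) t"
    using X by simp
  then have "fps_to_fls (F oo fps_X\<^sup>2) * chebyshev_U_fls k t * (2 * t * fls_X) =
      2 * t * chebyshev_U_fls (k - 1) t"
    by (metis mult.assoc mult.commute)
  then have "fps_to_fls (F oo fps_X\<^sup>2) * chebyshev_U_fls k t = 2 * t * chebyshev_U_fls (k - 1) t"
    by (simp only: tX mult_1_right)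
  with Un show ?thesis by (subst nonzero_eq_divide_eq)
qed

lemma chebyshev_R_unique:
  fixes F G :: "real fps"
  assumes "fps_to_fls (F oo fps_X\<^sup>2) = fps_to_fls (G oo fps_X\<^sup>2)"
  shows "F = G"
proof -
  have "(F - G) oo (fps_X :: real fps)\<^sup>2 = 0"
    using assms by (simp add: fps_compose_sub_distrib)
  then show ?thesis by (subst (asm) fps_compose_eq_0_iff) auto
qed

lemma chebyshev_R_quotient:
  assumes "1 \<le> k"
  shows "chebyshev_R k = fps_of_poly (chebyshev_P (k - 1)) / fps_of_poly (chebyshev_P k)"
  unfolding chebyshev_R_def Let_def
proof (rule the_equality)
  show "fps_to_fls (fps_of_poly (chebyshev_P (k - 1)) / fps_of_poly (chebyshev_P k) oo fps_X\<^sup>2) =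
      2 * (1 / (2 * fls_X)) * chebyshev_U_fls (k - 1) (1 / (2 * fls_X)) /
      chebyshev_U_fls k (1 / (2 * fls_X))"
    by (rule chebyshev_R_witness[OF assms])
next
  fix F :: "real fps"
  assume "fps_to_fls (F oo fps_X\<^sup>2) =
      2 * (1 / (2 * fls_X)) * chebyshev_U_fls (k - 1) (1 / (2 * fls_X)) /
      chebyshev_U_fls k (1 / (2 * fls_X))"
  then show "F = fps_of_poly (chebyshev_P (k - 1)) / fps_of_poly (chebyshev_P k)"
    by (intro chebyshev_R_unique) (simp only: chebyshev_R_witness[OF assms])
qed

lemma chebyshev_R_eq:
  fixes t :: "real fls"
  assumes "1 \<le> k" "t = 1 / (2 * fls_X)"
  shows "fps_to_fls (chebyshev_R k oo fps_X\<^sup>2) =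
    2 * t * chebyshev_U_fls (k - 1) t / chebyshev_U_fls k t"
  unfolding assms(2) chebyshev_R_quotient[OF assms(1)] by (rule chebyshev_R_witness[OF assms(1)])

lemma chebyshev_R_rational:
  assumes "1 \<le> k"
  obtains p q :: "real poly" where
    "poly q 0 \<noteq> 0" and "chebyshev_R k = fps_of_poly p / fps_of_poly q"
    and "\<And>x t. 0 < x \<Longrightarrow> t = 1 / (2 * sqrt x) \<Longrightarrow>
      2 * t * poly (chebyshev_U (k - 1)) t / poly (chebyshev_U k) t = poly p x / poly q x"
proof
  show "poly (chebyshev_P k) 0 \<noteq> 0" by (simp add: poly_chebyshev_P_0)
  show "chebyshev_R k = fps_of_poly (chebyshev_P (k - 1)) / fps_of_poly (chebyshev_P k)"
    using assms by (rule chebyshev_R_quotient)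
  fix x t :: real
  assume x: "0 < x" and t: "t = 1 / (2 * sqrt x)"
  define y where "y = sqrt x"
  have y: "y > 0" "y\<^sup>2 = x" "t = 1 / (2 * y)" using x t by (simp_all add: y_def)
  have D: "poly (chebyshev_P k) x = poly (chebyshev_U k) t * y ^ k"
    and N: "poly (chebyshev_P (k - 1)) x = poly (chebyshev_U (k - 1)) t * y ^ (k - 1)"
    using chebyshev_U_P_real[of y] y by simp_all
  have "y ^ k = y * y ^ (k - 1)" using assms by (cases k) simp_all
  then show "2 * t * poly (chebyshev_U (k - 1)) t / poly (chebyshev_U k) t =
      poly (chebyshev_P (k - 1)) x / poly (chebyshev_P k) x"
    unfolding D N using y(1,3) by simp
qed

end

(*
  A nonempty 132-avoiding permutation is (A + 1) \<ominus> B, where A + 1 means A followed by a new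
  maximum and \<ominus> is the skew sum; it is an involution iff it is A + 1 with A an involution, or
  (A + 1) \<ominus> E \<ominus> (A\<^sup>-\<^sup>1 + 1) with A arbitrary and E an involution.
  A wedge pattern is built from the empty word by steps u \<mapsto> (u + 1) \<ominus> 12...t, and such a step
  gives F = 1 + x (F_u F + (F - F_u) F_t) for the generating functions of 132-avoiding
  permutations; with R_k = P_(k-1) / P_k and P_(a+b) = P_a P_b - x P_(a-1) P_(b-1) this yields
  F = R_k for every wedge pattern of length k. A double-wedge pattern is (v + 1) \<ominus> (v\<^sup>-\<^sup>1 + 1),
  where v or its inverse is a wedge pattern, so that I = 1 + x I + x^2 R_(l-1)(x^2) I. For the
  increasing pattern I_m = 1 + x I_(m-1) + x^2 R_(m-1)(x^2) I_m, and the solution simplifies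
  for even m because P_(2l)(x^2) = P_l(x^2)^2 - x^2 P_(l-1)(x^2)^2 factors.
*)
theory Submission
  imports Defs
begin

text \<open>Everything rests on one fact: a word that ends in its maximum is not a skew sum of two
  nonempty words. It makes the decompositions unique, and it leaves an occurrence of p \<ominus> q,
  with p and q of this kind, only three places in a skew sum of two words: in the first block, in
  the second, or p in the first and q in the second. Containment thus reduces to conditions on the
  single blocks, which generating functions can count. The equations obtained are linear in the
  unknown series, and by the addition formula for P_k their solutions depend only on the length of
  the wedge pattern. For double-wedge patterns one condition on A governs both outer blocks, because
  A contains v exactly if the inverse of A contains the inverse of v. Blocks have varying lengths
  and are shifted, so permutations are handled as words; functions enter only where the given
  pattern and the counts are translated. Fractions are kept away as F P_k = P_(k-1); division by
  series with constant term 1 waits until the end.\<close>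

section \<open>Words, skew sums and top elements\<close>

definition perm_word :: "nat list \<Rightarrow> bool" where
  "perm_word w \<longleftrightarrow> distinct w \<and> set w = {1..length w}"

definition skew_sum :: "nat list \<Rightarrow> nat list \<Rightarrow> nat list"  (infixr "\<ominus>" 65) where
  "A \<ominus> B = map (\<lambda>x. x + length B) A @ B"

definition add_top :: "nat list \<Rightarrow> nat list" where
  "add_top A = A @ [Suc (length A)]"

lemma length_skew_sum [simp]: "length (A \<ominus> B) = length A + length B"
  by (simp add: skew_sum_def)

lemma length_add_top [simp]: "length (add_top A) = Suc (length A)"
  by (simp add: add_top_def)

lemma skew_sum_assoc: "(A \<ominus> B) \<ominus> C = A \<ominus> B \<ominus> C"
  by (simp add: skew_sum_def add.assoc add.commute)

lemma skew_sum_Nil [simp]: "A \<ominus> [] = A" "[] \<ominus> A = A"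
  by (simp_all add: skew_sum_def)

lemma skew_sum_cancel:
  assumes "A \<ominus> B = C \<ominus> D" "length A = length C"
  shows "A = C" "B = D"
proof -
  have "length B = length D" using arg_cong[OF assms(1), of length] assms(2) by simp
  with assms show "A = C" "B = D"
    by (auto simp: skew_sum_def inj_map_eq_map inj_on_def)
qed

lemma add_top_eq_iff [simp]: "add_top A = add_top B \<longleftrightarrow> A = B"
  by (auto simp: add_top_def)

lemma perm_word_le: "perm_word w \<Longrightarrow> x \<in> set w \<Longrightarrow> 1 \<le> x \<and> x \<le> length w"
  by (simp add: perm_word_def)

lemma perm_word_nth: "perm_word w \<Longrightarrow> i < length w \<Longrightarrow> 1 \<le> w ! i \<and> w ! i \<le> length w"
  using perm_word_le nth_mem by blast

lemma perm_wordI: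
  assumes "distinct w" "set w \<subseteq> {1..length w}"
  shows "perm_word w"
  using assms card_subset_eq[of "{1..length w}" "set w"]
  by (simp add: perm_word_def distinct_card)

lemma perm_word_Nil [simp]: "perm_word []"
  by (simp add: perm_word_def)

lemma perm_word_skew_sum:
  assumes "perm_word A" "perm_word B"
  shows "perm_word (A \<ominus> B)"
  using assms by (intro perm_wordI) (auto simp: skew_sum_def perm_word_def distinct_map inj_on_def)

lemma perm_word_add_top: "perm_word A \<Longrightarrow> perm_word (add_top A)"
  by (intro perm_wordI) (auto simp: add_top_def perm_word_def)

lemma perm_word_add_topD: "perm_word (add_top A) \<Longrightarrow> perm_word A"
proof (intro perm_wordI)
  assume "perm_word (add_top A)"
  then have d: "distinct A" "Suc (length A) \<notin> set A"
    and "insert (Suc (length A)) (set A) = {1..Suc (length A)}"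
    by (auto simp: perm_word_def add_top_def)
  then have s: "\<And>x. x \<in> set A \<Longrightarrow> 1 \<le> x \<and> x \<le> Suc (length A)" by (metis atLeastAtMost_iff insertCI)
  show "distinct A" by fact
  show "set A \<subseteq> {1..length A}" using s d(2) by (force simp: le_Suc_eq)
qed

lemma finite_perm_words: "finite {w. perm_word w \<and> length w = n \<and> P w}"
proof (rule finite_subset)
  show "{w. perm_word w \<and> length w = n \<and> P w} \<subseteq> {w. set w \<subseteq> {1..n} \<and> length w = n}"
    by (auto simp: perm_word_def)
qed (rule finite_lists_length_eq, simp)

text \<open>The values of V form a set that is downward closed in {1,...,n}, so counting shows that
  they are exactly 1,...,|V|. What remains for U lies above |V|, and subtracting |V| standardises
  it.\<close>

lemma perm_word_append_skew:
  assumes p: "perm_word (U @ V)" and gt: "\<And>x y. x \<in> set U \<Longrightarrow> y \<in> set V \<Longrightarrow> y < x"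
  obtains U' where "perm_word U'" "perm_word V" "U @ V = U' \<ominus> V"
proof -
  have d: "distinct U" "distinct V" and s: "set U \<union> set V = {1..length U + length V}"
    using p by (auto simp: perm_word_def)
  have "set V \<subseteq> {1..length V}"
  proof
    fix y assume y: "y \<in> set V"
    have "{1..y} \<subseteq> set V"
    proof
      fix x assume x: "x \<in> {1..y}"
      have "y \<le> length U + length V" using y s by auto
      then have "x \<in> set U \<union> set V" using s x by auto
      then show "x \<in> set V" using gt[of x y] x y by auto
    qed
    then have "card {1..y} \<le> card (set V)" by (intro card_mono) auto
    then show "y \<in> {1..length V}" using y s distinct_card[OF d(2)] by auto
  qed
  then have V: "perm_word V" using d by (intro perm_wordI)
  have U: "length V < x" if "x \<in> set U" for x
  proof (rule ccontr)
    assume "\<not> length V < x"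
    moreover have "1 \<le> x" using that s by auto
    ultimately have "x \<in> set V" using V by (auto simp: perm_word_def)
    then show False using gt[OF that] by blast
  qed
  define U' where "U' = map (\<lambda>x. x - length V) U"
  have eq: "U @ V = U' \<ominus> V"
    using U by (auto simp: U'_def skew_sum_def o_def intro!: map_idI[symmetric] dest!: U)
  have "perm_word U'"
  proof (rule perm_wordI)
    show "distinct U'" using d(1) U by (auto simp: U'_def distinct_map inj_on_def dest!: U)
    show "set U' \<subseteq> {1..length U'}" using U s
      by (auto simp: U'_def Suc_le_eq) (metis UnCI add.commute atLeastAtMost_iff le_diff_conv)
  qed
  with V eq that show thesis by blast
qed

text \<open>Two skew decompositions have a common refinement: cutting C after |A| entries yields the
  piece E that C and B share. The two shifts agree because |B| = |E| + |D|. This serves both to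
  prove uniqueness of decompositions and to compare a word with its inverse.\<close>

lemma skew_sum_eq_skew_sum:
  assumes p: "perm_word A" "perm_word B" "perm_word C" "perm_word D"
    and eq: "A \<ominus> B = C \<ominus> D" and le: "length A \<le> length C"
  obtains E where "perm_word E" "C = A \<ominus> E" "B = E \<ominus> D"
proof -
  define C1 E where "C1 = take (length A) C" and "E = drop (length A) C"
  have C: "C = C1 @ E" and l1: "length C1 = length A"
    using le by (simp_all add: C1_def E_def)
  have len: "length B = length E + length D"
    using arg_cong[OF eq, of length] C l1 by simp
  have "map (\<lambda>x. x + length B) A @ B = map (\<lambda>x. x + length D) C1 @ map (\<lambda>x. x + length D) E @ D"
    using eq C by (simp add: skew_sum_def)
  then have e: "map (\<lambda>x. x + length B) A = map (\<lambda>x. x + length D) C1"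
    and B: "B = map (\<lambda>x. x + length D) E @ D"
    using append_eq_append_conv[of "map (\<lambda>x. x + length B) A" "map (\<lambda>x. x + length D) C1"] l1
    by (metis length_map)+
  have "C1 = map (\<lambda>x. x + length E) A"
  proof (rule nth_equalityI)
    fix i assume "i < length C1"
    then show "C1 ! i = map (\<lambda>x. x + length E) A ! i"
      using arg_cong[OF e, of "\<lambda>xs. xs ! i"] l1 len by simp
  qed (simp add: l1)
  moreover have "perm_word E"
  proof (rule perm_wordI)
    show "distinct E" using p(3) C by (simp add: perm_word_def)
    show "set E \<subseteq> {1..length E}"
    proof
      fix x assume x: "x \<in> set E"
      then have "x + length D \<in> set B" using B by simp
      then have "x + length D \<le> length B" using p(2) by (simp add: perm_word_le)
      moreover have "1 \<le> x" using x C p(3) by (simp add: perm_word_def) (metis Un_iff One_nat_def atLeastAtMost_iff)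
      ultimately show "x \<in> {1..length E}" using len by simp
    qed
  qed
  ultimately show thesis using that C B by (simp add: skew_sum_def)
qed

text \<open>If B is nonempty, the last entry of the word belongs to B and is at most |B|; but it is
  the maximum |A| + |B|.\<close>

lemma add_top_eq_skew_sum:
  assumes "perm_word A" "perm_word B" "add_top C = A \<ominus> B"
  shows "A = [] \<or> B = []"
proof (rule disjCI)
  assume B: "B \<noteq> []"
  then have "last B \<le> length B" using assms(2) by (simp add: perm_word_le)
  moreover have "last (add_top C) = last B" using B assms(3) by (simp add: skew_sum_def)
  moreover have "last (add_top C) = length A + length B"
    using arg_cong[OF assms(3), of length] by (simp add: add_top_def)
  ultimately have "length A = 0" by linarith
  then show "A = []" by simp
qed

section \<open>Pattern containment in skew sums\<close>

lemma subseq_set: "subseq xs ys \<Longrightarrow> x \<in> set xs \<Longrightarrow> x \<in> set ys"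
  by (metis notin_set_nthsI subseq_conv_nths)

lemma subseq_singletonD: "subseq xs [y] \<Longrightarrow> xs = [] \<or> xs = [y]"
  by (cases xs) (auto split: if_splits)

lemma contains_pattern_subseq:
  "contains_pattern \<alpha> \<rho> \<Longrightarrow> subseq \<alpha> \<alpha>' \<Longrightarrow> contains_pattern \<alpha>' \<rho>"
  unfolding contains_pattern_def using subseq_order.order_trans by blast

lemma contains_pattern_Nil [simp]: "contains_pattern \<alpha> []"
  by (auto simp: contains_pattern_def order_isomorphic_def)

lemma contains_Nil_iff [simp]: "contains_pattern [] \<rho> \<longleftrightarrow> \<rho> = []"
  by (auto simp: contains_pattern_def order_isomorphic_def dest: list_emb_Nil2)

lemma order_isomorphic_shift [simp]:
  "order_isomorphic \<beta> (map (\<lambda>x. x + c) \<rho>) \<longleftrightarrow> order_isomorphic \<beta> \<rho>"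
  "order_isomorphic (map (\<lambda>x. x + c) \<beta>) \<rho> \<longleftrightarrow> order_isomorphic \<beta> \<rho>"
  by (auto simp: order_isomorphic_def)

lemma contains_shift_pattern [simp]:
  "contains_pattern \<alpha> (map (\<lambda>x. x + c) \<rho>) \<longleftrightarrow> contains_pattern \<alpha> \<rho>"
  by (simp add: contains_pattern_def)

lemma subseq_map_iff: "subseq \<beta> (map f \<alpha>) \<longleftrightarrow> (\<exists>\<gamma>. subseq \<gamma> \<alpha> \<and> \<beta> = map f \<gamma>)"
  by (auto simp: subseq_conv_nths nths_map)

lemma contains_shift_word [simp]:
  "contains_pattern (map (\<lambda>x. x + c) \<alpha>) \<rho> \<longleftrightarrow> contains_pattern \<alpha> \<rho>"
  by (auto simp: contains_pattern_def subseq_map_iff)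

lemma order_isomorphic_append:
  assumes "length \<beta> = length \<rho>"
  shows "order_isomorphic (\<beta> @ \<beta>') (\<rho> @ \<rho>') \<Longrightarrow> order_isomorphic \<beta> \<rho>"
    and "order_isomorphic (\<beta> @ \<beta>') (\<rho> @ \<rho>') \<Longrightarrow> order_isomorphic \<beta>' \<rho>'"
proof -
  assume o: "order_isomorphic (\<beta> @ \<beta>') (\<rho> @ \<rho>')"
  then have l: "length \<beta>' = length \<rho>'" using assms by (simp add: order_isomorphic_def)
  have o': "(\<beta> @ \<beta>') ! i < (\<beta> @ \<beta>') ! j \<longleftrightarrow> (\<rho> @ \<rho>') ! i < (\<rho> @ \<rho>') ! j"
    if "i < length \<beta> + length \<beta>'" "j < length \<beta> + length \<beta>'" for i j
    using o that by (simp add: order_isomorphic_def)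
  show "order_isomorphic \<beta> \<rho>"
    unfolding order_isomorphic_def
  proof (intro conjI allI impI assms)
    fix i j assume "i < length \<beta>" "j < length \<beta>"
    then show "\<beta> ! i < \<beta> ! j \<longleftrightarrow> \<rho> ! i < \<rho> ! j"
      using o'[of i j] assms by (simp add: nth_append)
  qed
  show "order_isomorphic \<beta>' \<rho>'"
    unfolding order_isomorphic_def
  proof (intro conjI allI impI l)
    fix i j assume "i < length \<beta>'" "j < length \<beta>'"
    then show "\<beta>' ! i < \<beta>' ! j \<longleftrightarrow> \<rho>' ! i < \<rho>' ! j"
      using o'[of "length \<beta> + i" "length \<beta> + j"] assms by (simp add: nth_append)
  qed
qed

lemma order_isomorphic_less:
  assumes "order_isomorphic (\<beta> @ \<beta>') (\<rho> @ \<rho>')" "length \<beta> = length \<rho>"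
    and "\<And>x y. x \<in> set \<beta> \<Longrightarrow> y \<in> set \<beta>' \<Longrightarrow> y < x"
    and "x \<in> set \<rho>" "y \<in> set \<rho>'"
  shows "y < x"
proof -
  obtain i j where ij: "i < length \<rho>" "x = \<rho> ! i" "j < length \<rho>'" "y = \<rho>' ! j"
    using assms(4,5) by (auto simp: in_set_conv_nth)
  have l: "length \<beta>' = length \<rho>'" using assms(1,2) by (simp add: order_isomorphic_def)
  have "(\<beta> @ \<beta>') ! (length \<beta> + j) < (\<beta> @ \<beta>') ! i \<longleftrightarrow> (\<rho> @ \<rho>') ! (length \<beta> + j) < (\<rho> @ \<rho>') ! i"
    using assms(1,2) ij l by (simp add: order_isomorphic_def)
  moreover have "\<beta>' ! j < \<beta> ! i" using assms(2,3) ij l by simp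
  ultimately show ?thesis using ij assms(2) by (simp add: nth_append)
qed

lemma order_isomorphic_skew_append:
  assumes "order_isomorphic \<beta> \<rho>" "order_isomorphic \<beta>' \<rho>'"
    and "\<And>x y. x \<in> set \<beta> \<Longrightarrow> y \<in> set \<beta>' \<Longrightarrow> y < x"
    and "\<And>x y. x \<in> set \<rho> \<Longrightarrow> y \<in> set \<rho>' \<Longrightarrow> y < x"
  shows "order_isomorphic (\<beta> @ \<beta>') (\<rho> @ \<rho>')"
proof -
  have l: "length \<beta> = length \<rho>" "length \<beta>' = length \<rho>'"
    using assms by (simp_all add: order_isomorphic_def)
  have less: "\<beta>' ! j < \<beta> ! i" "\<rho>' ! j < \<rho> ! i" "\<not> \<beta> ! i < \<beta>' ! j" "\<not> \<rho> ! i < \<rho>' ! j"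
    if "i < length \<rho>" "j < length \<rho>'" for i j
    using assms(3)[of "\<beta> ! i" "\<beta>' ! j"] assms(4)[of "\<rho> ! i" "\<rho>' ! j"] that l by simp_all
  show ?thesis
    unfolding order_isomorphic_def
  proof (intro conjI allI impI)
    fix i j assume ij: "i < length (\<beta> @ \<beta>')" "j < length (\<beta> @ \<beta>')"
    show "(\<beta> @ \<beta>') ! i < (\<beta> @ \<beta>') ! j \<longleftrightarrow> (\<rho> @ \<rho>') ! i < (\<rho> @ \<rho>') ! j"
      using assms(1,2) ij l less[of i "j - length \<rho>"] less[of j "i - length \<rho>"]
      by (auto simp: nth_append order_isomorphic_def)
  qed (use l in simp)
qed

text \<open>An occurrence is cut where it passes from A to B, and the pattern is cut at the same
  index. Since A lies above B, the cut of the pattern is forced to be a skew cut as well, and any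
  two occurrences of the halves fit together.\<close>

lemma contains_append_skew:
  assumes "\<And>x y. x \<in> set A \<Longrightarrow> y \<in> set B \<Longrightarrow> y < x"
  shows "contains_pattern (A @ B) \<rho> \<longleftrightarrow>
    (\<exists>\<rho>1 \<rho>2. \<rho> = \<rho>1 @ \<rho>2 \<and> (\<forall>x\<in>set \<rho>1. \<forall>y\<in>set \<rho>2. y < x) \<and>
      contains_pattern A \<rho>1 \<and> contains_pattern B \<rho>2)" (is "?L \<longleftrightarrow> ?R")
proof
  assume ?L
  then obtain \<beta> where \<beta>: "subseq \<beta> (A @ B)" "order_isomorphic \<beta> \<rho>"
    by (auto simp: contains_pattern_def)
  then obtain \<beta>1 \<beta>2 where b: "\<beta> = \<beta>1 @ \<beta>2" "subseq \<beta>1 A" "subseq \<beta>2 B"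
    by (auto simp: subseq_append_iff)
  define \<rho>1 \<rho>2 where "\<rho>1 = take (length \<beta>1) \<rho>" and "\<rho>2 = drop (length \<beta>1) \<rho>"
  have \<rho>: "\<rho> = \<rho>1 @ \<rho>2" "length \<beta>1 = length \<rho>1"
    using \<beta>(2) b(1) by (simp_all add: \<rho>1_def \<rho>2_def order_isomorphic_def min_def)
  have o: "order_isomorphic (\<beta>1 @ \<beta>2) (\<rho>1 @ \<rho>2)" using \<beta>(2) b(1) \<rho>(1) by simp
  have "y < x" if "x \<in> set \<beta>1" "y \<in> set \<beta>2" for x y
    using that b assms by (blast dest: subseq_set)
  then have "\<forall>x\<in>set \<rho>1. \<forall>y\<in>set \<rho>2. y < x"
    using order_isomorphic_less[OF o \<rho>(2)] by blast
  then show ?R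
    using \<rho>(1) order_isomorphic_append[OF \<rho>(2) o] b(2,3) unfolding contains_pattern_def by blast
next
  assume ?R
  then obtain \<rho>1 \<rho>2 \<beta>1 \<beta>2 where
    r: "\<rho> = \<rho>1 @ \<rho>2" "\<forall>x\<in>set \<rho>1. \<forall>y\<in>set \<rho>2. y < x"
    and b: "subseq \<beta>1 A" "subseq \<beta>2 B" and o: "order_isomorphic \<beta>1 \<rho>1" "order_isomorphic \<beta>2 \<rho>2"
    by (auto simp: contains_pattern_def)
  have "y < x" if "x \<in> set \<beta>1" "y \<in> set \<beta>2" for x y
    using that b assms by (blast dest: subseq_set)
  then have "order_isomorphic (\<beta>1 @ \<beta>2) \<rho>"
    using order_isomorphic_skew_append[OF o] r by blast
  moreover have "subseq (\<beta>1 @ \<beta>2) (A @ B)" using b by (simp add: list_emb_append_mono)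
  ultimately show ?L unfolding contains_pattern_def by blast
qed


lemma contains_skew_sum:
  assumes "perm_word A" "perm_word B"
  shows "contains_pattern (A \<ominus> B) \<rho> \<longleftrightarrow>
    (\<exists>\<rho>1 \<rho>2. \<rho> = \<rho>1 @ \<rho>2 \<and> (\<forall>x\<in>set \<rho>1. \<forall>y\<in>set \<rho>2. y < x) \<and>
      contains_pattern A \<rho>1 \<and> contains_pattern B \<rho>2)"
proof -
  have "y < x" if "x \<in> set (map (\<lambda>x. x + length B) A)" "y \<in> set B" for x y
    using that assms by (force simp: perm_word_def)
  from contains_append_skew[of "map (\<lambda>x. x + length B) A" B \<rho>, OF this] show ?thesis
    by (simp add: skew_sum_def)
qed

lemma contains_appendD:
  assumes "contains_pattern \<alpha> (\<rho>1 @ \<rho>2)"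
  shows "contains_pattern \<alpha> \<rho>1" "contains_pattern \<alpha> \<rho>2"
proof -
  obtain \<beta> where b: "subseq \<beta> \<alpha>" "order_isomorphic \<beta> (\<rho>1 @ \<rho>2)"
    using assms by (auto simp: contains_pattern_def)
  define \<beta>1 \<beta>2 where "\<beta>1 = take (length \<rho>1) \<beta>" and "\<beta>2 = drop (length \<rho>1) \<beta>"
  have \<beta>: "\<beta> = \<beta>1 @ \<beta>2" "length \<beta>1 = length \<rho>1"
    using b(2) by (simp_all add: \<beta>1_def \<beta>2_def order_isomorphic_def min_def)
  have s: "subseq \<beta>1 \<alpha>" "subseq \<beta>2 \<alpha>"
    using b(1) \<beta>(1) subseq_order.order_trans[of _ \<beta> \<alpha>] by auto
  have "order_isomorphic (\<beta>1 @ \<beta>2) (\<rho>1 @ \<rho>2)" using b(2) \<beta>(1) by simp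
  from order_isomorphic_append[OF \<beta>(2) this] s
  show "contains_pattern \<alpha> \<rho>1" "contains_pattern \<alpha> \<rho>2" unfolding contains_pattern_def by blast+
qed

lemma contains_skew_sumI:
  "contains_pattern A \<rho> \<Longrightarrow> contains_pattern (A \<ominus> B) \<rho>"
  "contains_pattern B \<rho> \<Longrightarrow> contains_pattern (A \<ominus> B) \<rho>"
  using contains_pattern_subseq[of "map (\<lambda>x. x + length B) A" \<rho> "A \<ominus> B"]
    contains_pattern_subseq[of B \<rho> "A \<ominus> B"]
  by (simp_all add: skew_sum_def list_emb_prefix list_emb_append2)

lemma contains_skew_sumD:
  assumes "contains_pattern \<alpha> (p \<ominus> q)"
  shows "contains_pattern \<alpha> p" "contains_pattern \<alpha> q"
  using contains_appendD[of \<alpha> "map (\<lambda>x. x + length q) p" q] assms by (simp_all add: skew_sum_def)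

text \<open>Only the last letter of an occurrence can sit at the position of m, so deleting that
  letter leaves an occurrence of p in A. Conversely, m dominates A just as k dominates p.\<close>

lemma contains_snoc_snoc:
  assumes A: "\<And>x. x \<in> set A \<Longrightarrow> x < m" and p: "\<And>x. x \<in> set p \<Longrightarrow> x < k"
  shows "contains_pattern (A @ [m]) (p @ [k]) \<longleftrightarrow> contains_pattern A p"
proof
  assume "contains_pattern (A @ [m]) (p @ [k])"
  then obtain \<beta> where b: "subseq \<beta> (A @ [m])" "order_isomorphic \<beta> (p @ [k])"
    by (auto simp: contains_pattern_def)
  then have "length \<beta> = length p + 1" by (simp add: order_isomorphic_def)
  then obtain \<beta>' z where \<beta>: "\<beta> = \<beta>' @ [z]" "length \<beta>' = length p"
    by (metis Suc_eq_plus1 length_Suc_conv_rev)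
  have "subseq \<beta>' A"
  proof -
    obtain \<beta>1 \<beta>2 where s: "\<beta>' @ [z] = \<beta>1 @ \<beta>2" "subseq \<beta>1 A" "subseq \<beta>2 [m]"
      using b(1) \<beta>(1) by (auto simp: subseq_append_iff)
    then have "\<beta>2 = [] \<or> \<beta>2 = [m]" by (simp add: subseq_singletonD)
    then have "subseq \<beta>' \<beta>1" using s(1) list_emb_prefix[of _ \<beta>' \<beta>'] by auto
    with s(2) show ?thesis using subseq_order.order_trans by blast
  qed
  moreover have "order_isomorphic \<beta>' p" using order_isomorphic_append(1)[OF \<beta>(2)] b(2) \<beta>(1) by blast
  ultimately show "contains_pattern A p" by (auto simp: contains_pattern_def)
next
  assume "contains_pattern A p"
  then obtain \<beta> where b: "subseq \<beta> A" "order_isomorphic \<beta> p"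
    by (auto simp: contains_pattern_def)
  have l: "length \<beta> = length p" using b(2) by (simp add: order_isomorphic_def)
  have \<beta>: "x < m" if "x \<in> set \<beta>" for x
    using that b A by (blast dest: subseq_set)
  have "order_isomorphic (\<beta> @ [m]) (p @ [k])"
    unfolding order_isomorphic_def
  proof (intro conjI allI impI)
    fix i j assume ij: "i < length (\<beta> @ [m])" "j < length (\<beta> @ [m])"
    have "\<beta> ! i < m" "p ! i < k" "\<not> m < \<beta> ! i" "\<not> k < p ! i" if "i < length p" for i
      using that \<beta>[of "\<beta> ! i"] p[of "p ! i"] l by simp_all
    then show "(\<beta> @ [m]) ! i < (\<beta> @ [m]) ! j \<longleftrightarrow> (p @ [k]) ! i < (p @ [k]) ! j"
      using b(2) ij l by (auto simp: nth_append order_isomorphic_def less_Suc_eq)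
  qed (simp add: l)
  moreover have "subseq (\<beta> @ [m]) (A @ [m])" using b(1) by simp
  ultimately show "contains_pattern (A @ [m]) (p @ [k])" unfolding contains_pattern_def by blast
qed

lemma contains_add_top_add_top:
  assumes "perm_word A" "perm_word p"
  shows "contains_pattern (add_top A) (add_top p) \<longleftrightarrow> contains_pattern A p"
  unfolding add_top_def
  by (rule contains_snoc_snoc) (use assms in \<open>auto dest: perm_word_le\<close>)

lemma contains_add_topD: "contains_pattern \<alpha> (add_top p) \<Longrightarrow> contains_pattern \<alpha> p"
  unfolding add_top_def by (rule contains_appendD(1))

lemma subseq_add_top [simp]: "subseq A (add_top A)"
  by (simp add: add_top_def list_emb_prefix)

text \<open>The new maximum stands at the end of the word, so it could only represent the last entry
  of the pattern; that entry is not a maximum of the pattern.\<close>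

lemma contains_add_top_iff:
  assumes A: "perm_word A" and x: "x \<in> set \<rho>" "last \<rho> < x"
  shows "contains_pattern (add_top A) \<rho> \<longleftrightarrow> contains_pattern A \<rho>"
proof
  assume "contains_pattern (add_top A) \<rho>"
  then obtain \<beta> where b: "subseq \<beta> (A @ [Suc (length A)])" "order_isomorphic \<beta> \<rho>"
    by (auto simp: contains_pattern_def add_top_def)
  then obtain \<beta>1 \<beta>2 where \<beta>: "\<beta> = \<beta>1 @ \<beta>2" "subseq \<beta>1 A" "subseq \<beta>2 [Suc (length A)]"
    by (auto simp: subseq_append_iff)
  have "\<beta>2 = []"
  proof (rule ccontr)
    assume "\<beta>2 \<noteq> []"
    then have \<beta>2: "\<beta>2 = [Suc (length A)]"
      using subseq_singletonD[OF \<beta>(3)] by simp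
    obtain i where i: "i < length \<rho>" "\<rho> ! i = x" using x(1) by (auto simp: in_set_conv_nth)
    have l: "length \<rho> = Suc (length \<beta>1)" using b(2) \<beta> \<beta>2 by (simp add: order_isomorphic_def)
    then have "\<rho> \<noteq> []" by auto
    then have last: "last \<rho> = \<rho> ! length \<beta>1" using l by (simp add: last_conv_nth)
    then have "i \<noteq> length \<beta>1" using i x(2) by auto
    then have i': "i < length \<beta>1" using i l by simp
    have "\<beta> ! length \<beta>1 < \<beta> ! i"
      using b(2) l i' x(2) last i by (simp add: order_isomorphic_def)
    then have "Suc (length A) < \<beta>1 ! i" using i' by (simp add: \<beta>(1) \<beta>2 nth_append)
    moreover have "\<beta>1 ! i \<in> set A"
      using subseq_set[OF \<beta>(2) nth_mem[OF i']] .
    ultimately show False using A by (auto dest: perm_word_le)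
  qed
  then show "contains_pattern A \<rho>" using b(2) \<beta> by (auto simp: contains_pattern_def)
qed (rule contains_pattern_subseq, assumption, simp)

text \<open>Phrased by comparing values instead of by \<open>\<ominus>\<close>, because the halves
  of a pattern produced by \<open>contains_skew_sum\<close> are factors that need not be
  standardised.\<close>

definition skew_indecomposable :: "nat list \<Rightarrow> bool" where
  "skew_indecomposable p \<longleftrightarrow>
     (\<forall>\<rho>1 \<rho>2. p = \<rho>1 @ \<rho>2 \<longrightarrow> (\<forall>x\<in>set \<rho>1. \<forall>y\<in>set \<rho>2. y < x) \<longrightarrow> \<rho>1 = [] \<or> \<rho>2 = [])"

lemma skew_indecomposableD:
  assumes "skew_indecomposable (\<rho>1 @ \<rho>2)" "\<And>x y. x \<in> set \<rho>1 \<Longrightarrow> y \<in> set \<rho>2 \<Longrightarrow> y < x"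
  shows "\<rho>1 = [] \<or> \<rho>2 = []"
  using assms by (auto simp: skew_indecomposable_def)

lemma skew_indecomposable_Nil [simp]: "skew_indecomposable []"
  by (simp add: skew_indecomposable_def)

lemma skew_indecomposable_132: "skew_indecomposable [1, 3, 2]"
  by (auto simp: skew_indecomposable_def Cons_eq_append_conv)

lemma skew_indecomposable_add_top:
  assumes "perm_word u"
  shows "skew_indecomposable (add_top u)"
  unfolding skew_indecomposable_def
proof (intro allI impI disjCI)
  fix \<rho>1 \<rho>2 assume eq: "add_top u = \<rho>1 @ \<rho>2" and less: "\<forall>x\<in>set \<rho>1. \<forall>y\<in>set \<rho>2. y < x" and "\<rho>2 \<noteq> []"
  then have "last \<rho>2 = last (add_top u)" by simp
  then have l: "last \<rho>2 = Suc (length u)" by (simp add: add_top_def)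
  have False if x: "x \<in> set \<rho>1" for x
  proof -
    have "x \<in> set (add_top u)" using eq x by simp
    then have "x \<le> Suc (length u)" using perm_word_le[OF perm_word_add_top[OF assms]] by simp
    moreover have "last \<rho>2 < x" using less x \<open>\<rho>2 \<noteq> []\<close> by simp
    ultimately show False using l by simp
  qed
  then show "\<rho>1 = []" by (cases \<rho>1) auto
qed

lemma skew_indecomposable_shift:
  assumes "skew_indecomposable q"
  shows "skew_indecomposable (map (\<lambda>x. x + c) q)"
  unfolding skew_indecomposable_def
proof (intro allI impI)
  fix \<rho>1 \<rho>2 assume "map (\<lambda>x. x + c) q = \<rho>1 @ \<rho>2" and less: "\<forall>x\<in>set \<rho>1. \<forall>y\<in>set \<rho>2. y < x"
  then obtain q1 q2 where q: "q = q1 @ q2" "\<rho>1 = map (\<lambda>x. x + c) q1" "\<rho>2 = map (\<lambda>x. x + c) q2"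
    by (auto simp: map_eq_append_conv)
  then have "q1 = [] \<or> q2 = []" using assms less by (intro skew_indecomposableD) auto
  then show "\<rho>1 = [] \<or> \<rho>2 = []" using q by simp
qed

lemma contains_skew_sum_indecomposable:
  assumes "perm_word A" "perm_word B" "skew_indecomposable p"
  shows "contains_pattern (A \<ominus> B) p \<longleftrightarrow> contains_pattern A p \<or> contains_pattern B p"
    (is "?L \<longleftrightarrow> ?R")
proof
  assume ?L
  then obtain \<rho>1 \<rho>2 where "p = \<rho>1 @ \<rho>2" "\<forall>x\<in>set \<rho>1. \<forall>y\<in>set \<rho>2. y < x"
      "contains_pattern A \<rho>1" "contains_pattern B \<rho>2"
    using contains_skew_sum[OF assms(1,2)] by blast
  then show ?R using skew_indecomposableD[of \<rho>1 \<rho>2] assms(3) by auto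
next
  assume ?R
  then show ?L using contains_skew_sumI by blast
qed

text \<open>The only skew cuts of p \<ominus> q are its two ends and the border between p and q.
  Each of them accounts for one of the three alternatives.\<close>

lemma contains_skew_sum_skew_sum:
  assumes AB: "perm_word A" "perm_word B" and pq: "perm_word p" "perm_word q"
    and t: "skew_indecomposable p" "skew_indecomposable q"
  shows "contains_pattern (A \<ominus> B) (p \<ominus> q) \<longleftrightarrow>
    contains_pattern A (p \<ominus> q) \<or> contains_pattern B (p \<ominus> q) \<or>
    contains_pattern A p \<and> contains_pattern B q" (is "?L \<longleftrightarrow> ?R")
proof
  assume ?L
  then obtain \<rho>1 \<rho>2 where \<rho>: "p \<ominus> q = \<rho>1 @ \<rho>2" "\<And>x y. x\<in>set \<rho>1 \<Longrightarrow> y\<in>set \<rho>2 \<Longrightarrow> y < x"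
      and c: "contains_pattern A \<rho>1" "contains_pattern B \<rho>2"
    using contains_skew_sum[OF AB, of "p \<ominus> q"] by auto
  define p' where "p' = map (\<lambda>x. x + length q) p"
  have t': "skew_indecomposable p'" using t(1) by (simp add: p'_def skew_indecomposable_shift)
  have cp: "contains_pattern A p' \<longleftrightarrow> contains_pattern A p" by (simp add: p'_def)
  have "p' @ q = \<rho>1 @ \<rho>2" using \<rho>(1) by (simp add: skew_sum_def p'_def)
  \<comment> \<open>\<open>z\<close> is the piece between the cut of the pattern and the border of p
    and q. It is a factor of p or of q, and indecomposability pushes the cut to an end of that
    summand.\<close>
  then obtain z where "p' = \<rho>1 @ z \<and> z @ q = \<rho>2 \<or> p' @ z = \<rho>1 \<and> q = z @ \<rho>2"
    by (metis append_eq_append_conv2)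
  then consider (1) "p' = \<rho>1 @ z" "z @ q = \<rho>2" | (2) "p' @ z = \<rho>1" "q = z @ \<rho>2" by blast
  then show ?R
  proof cases
    case 1
    then have "\<rho>1 = [] \<or> z = []" using t' \<rho>(2) by (intro skew_indecomposableD) auto
    then show ?thesis
    proof
      assume "\<rho>1 = []"
      then show ?thesis using \<rho>(1) c by simp
    next
      assume "z = []"
      then show ?thesis using 1 c cp by auto
    qed
  next
    case 2
    then have "z = [] \<or> \<rho>2 = []" using t(2) \<rho>(2) by (intro skew_indecomposableD) auto
    then show ?thesis
    proof
      assume "\<rho>2 = []"
      then show ?thesis using \<rho>(1) c by simp
    next
      assume "z = []"
      then show ?thesis using 2 c cp by auto
    qed
  qed
next
  have gt: "y < x" if "x \<in> set (map (\<lambda>x. x + length q) p)" "y \<in> set q" for x y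
    using that pq by (force simp: perm_word_def)
  have "contains_pattern (A \<ominus> B) (p \<ominus> q)" if "contains_pattern A p" "contains_pattern B q"
    unfolding contains_skew_sum[OF AB]
    by (rule exI[of _ "map (\<lambda>x. x + length q) p"], rule exI[of _ q])
      (use that gt in \<open>auto simp: skew_sum_def\<close>)
  moreover assume ?R
  ultimately show ?L using contains_skew_sumI by blast
qed

section \<open>Inverse words\<close>

text \<open>Defined on words so that it can be computed block by block on skew sums. Positions count
  from 0 and values from 1, whence the \<open>Suc\<close>.\<close>

definition inverse_word :: "nat list \<Rightarrow> nat list" where
  "inverse_word w = map (\<lambda>v. Suc (THE i. i < length w \<and> w ! i = v)) [1..<Suc (length w)]"

lemma length_inverse_word [simp]: "length (inverse_word w) = length w"
  by (simp add: inverse_word_def del: upt_Suc)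

lemma perm_word_surj:
  assumes "perm_word w" "j < length w"
  obtains i where "i < length w" "w ! i = Suc j"
proof -
  have "Suc j \<in> set w" using assms by (simp add: perm_word_def)
  then show thesis using that by (auto simp: in_set_conv_nth)
qed

lemma perm_word_nth_eq:
  "perm_word w \<Longrightarrow> i < length w \<Longrightarrow> j < length w \<Longrightarrow> w ! i = w ! j \<longleftrightarrow> i = j"
  by (simp add: perm_word_def nth_eq_iff_index_eq)

lemma inverse_word_nth:
  assumes "perm_word w" "i < length w" "j < length w"
  shows "inverse_word w ! j = Suc i \<longleftrightarrow> w ! i = Suc j"
proof -
  obtain k where k: "k < length w" "w ! k = Suc j" using perm_word_surj assms(1,3) by blast
  have "(THE i. i < length w \<and> w ! i = Suc j) = k"
    using k perm_word_nth_eq[OF assms(1)] by (intro the_equality) (simp, metis)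
  then have "inverse_word w ! j = Suc k" using assms(3) by (simp add: inverse_word_def nth_upt del: upt_Suc)
  then show ?thesis using k perm_word_nth_eq[OF assms(1), of i k] assms(2) by auto
qed

lemma inverse_word_eqI:
  assumes "perm_word w" "length v = length w"
    and "\<And>i j. i < length w \<Longrightarrow> j < length w \<Longrightarrow> w ! i = Suc j \<Longrightarrow> v ! j = Suc i"
  shows "inverse_word w = v"
proof (rule nth_equalityI)
  fix j assume "j < length (inverse_word w)"
  then have j: "j < length w" by simp
  then obtain i where i: "i < length w" "w ! i = Suc j" using perm_word_surj assms(1) by blast
  then show "inverse_word w ! j = v ! j"
    using inverse_word_nth[OF assms(1)] assms(3) j by simp
qed (simp add: assms)

lemma perm_word_inverse_word:
  assumes w: "perm_word w"
  shows "perm_word (inverse_word w)"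
proof (rule perm_wordI)
  have iw: "\<exists>i<length w. inverse_word w ! j = Suc i \<and> w ! i = Suc j" if j: "j < length w" for j
    using perm_word_surj[OF w j] inverse_word_nth[OF w _ j] by metis
  show "distinct (inverse_word w)"
    unfolding distinct_conv_nth by (metis iw length_inverse_word nat.inject)
  show "set (inverse_word w) \<subseteq> {1..length (inverse_word w)}"
  proof
    fix x assume "x \<in> set (inverse_word w)"
    then obtain j where "j < length w" "x = inverse_word w ! j" by (auto simp: in_set_conv_nth)
    with iw[of j] show "x \<in> {1..length (inverse_word w)}" by auto
  qed
qed

lemma inverse_word_inverse_word [simp]: "perm_word w \<Longrightarrow> inverse_word (inverse_word w) = w"
  by (rule inverse_word_eqI) (simp_all add: perm_word_inverse_word inverse_word_nth)

lemma inverse_word_Nil [simp]: "inverse_word [] = []"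
  by (simp add: inverse_word_def)

text \<open>Inversion reflects the diagram in the main diagonal, which exchanges the upper left
  block with the lower right one and inverts each. A top element lies on the diagonal and stays in
  place, as \<open>inverse_word_add_top\<close> records.\<close>

lemma inverse_word_skew_sum:
  assumes "perm_word A" "perm_word B"
  shows "inverse_word (A \<ominus> B) = inverse_word B \<ominus> inverse_word A"
proof (rule inverse_word_eqI)
  fix i j assume ij: "i < length (A \<ominus> B)" "j < length (A \<ominus> B)" and eq: "(A \<ominus> B) ! i = Suc j"
  show "(inverse_word B \<ominus> inverse_word A) ! j = Suc i"
  proof (cases "i < length A")
    case True
    then have "A ! i + length B = Suc j" using eq by (simp add: skew_sum_def nth_append)
    moreover have "1 \<le> A ! i \<and> A ! i \<le> length A" using perm_word_nth assms(1) True by blast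
    ultimately obtain j' where j': "j = length B + j'" "A ! i = Suc j'" "j' < length A"
      using that[of "A ! i - 1"] by force
    then show ?thesis using True inverse_word_nth[OF assms(1) True j'(3)]
      by (simp add: skew_sum_def nth_append)
  next
    case False
    define i' where "i' = i - length A"
    have i': "i = length A + i'" "i' < length B" using False ij by (simp_all add: i'_def)
    then have B: "B ! i' = Suc j" using eq by (simp add: skew_sum_def nth_append)
    then have "j < length B" using perm_word_nth[OF assms(2) i'(2)] by simp
    then show ?thesis using B i' inverse_word_nth[OF assms(2) i'(2)]
      by (simp add: skew_sum_def nth_append)
  qed
qed (simp_all add: perm_word_skew_sum assms)

lemma inverse_word_add_top:
  assumes "perm_word A"
  shows "inverse_word (add_top A) = add_top (inverse_word A)"
proof (rule inverse_word_eqI)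
  fix i j assume ij: "i < length (add_top A)" "j < length (add_top A)" and eq: "add_top A ! i = Suc j"
  show "add_top (inverse_word A) ! j = Suc i"
  proof (cases "i < length A")
    case True
    then have A: "A ! i = Suc j" using eq by (simp add: add_top_def nth_append)
    then have "j < length A" using perm_word_nth[OF assms True] by simp
    then show ?thesis using A True inverse_word_nth[OF assms True] by (simp add: add_top_def nth_append)
  next
    case False
    then show ?thesis using eq ij by (simp add: add_top_def nth_append)
  qed
qed (simp_all add: perm_word_add_top assms)

section \<open>Occurrences as increasing index maps, and their inverses\<close>

lemma subseq_iff_nth:
  "subseq \<beta> \<alpha> \<longleftrightarrow> (\<exists>is. sorted_wrt (<) is \<and> set is \<subseteq> {..<length \<alpha>} \<and> \<beta> = map ((!) \<alpha>) is)"
proof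
  assume "subseq \<beta> \<alpha>"
  then obtain N where "\<beta> = nths \<alpha> N" by (auto simp: subseq_conv_nths)
  also have "\<dots> = nths (map ((!) \<alpha>) [0..<length \<alpha>]) N" by (simp only: map_nth)
  finally have "\<beta> = map ((!) \<alpha>) (nths [0..<length \<alpha>] N)" by (simp only: nths_map)
  moreover have "sorted_wrt (<) (nths [0..<length \<alpha>] N)"
    by (simp add: strict_sorted_iff sorted_nths distinct_nthsI)
  moreover have "set (nths [0..<length \<alpha>] N) \<subseteq> {..<length \<alpha>}"
    using set_nths_subset[of "[0..<length \<alpha>]" N] by (auto simp: set_nths)
  ultimately show "\<exists>is. sorted_wrt (<) is \<and> set is \<subseteq> {..<length \<alpha>} \<and> \<beta> = map ((!) \<alpha>) is" by blast
next
  assume "\<exists>is. sorted_wrt (<) is \<and> set is \<subseteq> {..<length \<alpha>} \<and> \<beta> = map ((!) \<alpha>) is"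
  then obtain "is" where i: "sorted_wrt (<) is" "set is \<subseteq> {..<length \<alpha>}" "\<beta> = map ((!) \<alpha>) is" by blast
  have "subseq is [0..<length \<alpha>]"
    using i(1,2) by (intro sorted_subset_imp_subseq) (auto simp: strict_sorted_iff)
  then have "subseq (map ((!) \<alpha>) is) (map ((!) \<alpha>) [0..<length \<alpha>])" by (rule subseq_map)
  then show "subseq \<beta> \<alpha>" by (simp only: map_nth i(3))
qed

lemma contains_pattern_iff_nth:
  "contains_pattern \<alpha> \<rho> \<longleftrightarrow> (\<exists>f. (\<forall>i<length \<rho>. f i < length \<alpha>) \<and>
     (\<forall>j<length \<rho>. \<forall>i<j. f i < f j) \<and>
     (\<forall>i<length \<rho>. \<forall>j<length \<rho>. \<alpha> ! f i < \<alpha> ! f j \<longleftrightarrow> \<rho> ! i < \<rho> ! j))" (is "?L \<longleftrightarrow> ?R")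
proof
  assume ?L
  then obtain "is" where i: "sorted_wrt (<) is" "set is \<subseteq> {..<length \<alpha>}"
      and o: "order_isomorphic (map ((!) \<alpha>) is) \<rho>"
    by (auto simp: contains_pattern_def subseq_iff_nth)
  show ?R
    by (rule exI[of _ "(!) is"])
      (use i o in \<open>auto simp: order_isomorphic_def sorted_wrt_iff_nth_less subset_iff\<close>)
next
  assume ?R
  then obtain f where f: "\<forall>i<length \<rho>. f i < length \<alpha>" "\<forall>j<length \<rho>. \<forall>i<j. f i < f j"
     "\<forall>i<length \<rho>. \<forall>j<length \<rho>. \<alpha> ! f i < \<alpha> ! f j \<longleftrightarrow> \<rho> ! i < \<rho> ! j" by blast
  define xs where "xs = map f [0..<length \<rho>]"
  have "sorted_wrt (<) xs" "set xs \<subseteq> {..<length \<alpha>}"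
    using f(1,2) by (auto simp: xs_def sorted_wrt_iff_nth_less)
  moreover have "order_isomorphic (map ((!) \<alpha>) xs) \<rho>"
    using f(3) by (auto simp: xs_def order_isomorphic_def)
  ultimately show ?L unfolding contains_pattern_def subseq_iff_nth by blast
qed

text \<open>Reflecting the points of an occurrence in the diagonal gives an occurrence of the
  reflected pattern. Its positions are the old values in increasing order, and its values are the
  old positions.\<close>

lemma contains_pattern_inverse_word:
  assumes \<alpha>: "perm_word \<alpha>" and \<rho>: "perm_word \<rho>" and c: "contains_pattern \<alpha> \<rho>"
  shows "contains_pattern (inverse_word \<alpha>) (inverse_word \<rho>)"
proof -
  let ?k = "length \<rho>"
  obtain f where *: "\<forall>i<?k. f i < length \<alpha>" "\<forall>j<?k. \<forall>i<j. f i < f j"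
    "\<forall>i<?k. \<forall>j<?k. \<alpha> ! f i < \<alpha> ! f j \<longleftrightarrow> \<rho> ! i < \<rho> ! j"
    using c unfolding contains_pattern_iff_nth by (elim exE conjE)
  note f = *(1)[rule_format] *(2)[rule_format] *(3)[rule_format]
  \<comment> \<open>\<open>r j\<close> is the index at which \<rho> has the value
    \<open>Suc j\<close>, and \<open>g j\<close> is, counted from 0, the value of \<alpha> that
    represents it in the occurrence.\<close>
  define r where "r j = inverse_word \<rho> ! j - 1" for j
  define g where "g j = \<alpha> ! f (r j) - 1" for j
  have r: "r j < ?k" "inverse_word \<rho> ! j = Suc (r j)" if "j < ?k" for j
    using perm_word_nth[OF perm_word_inverse_word[OF \<rho>], of j] that by (auto simp: r_def)
  have \<rho>r: "\<rho> ! r j = Suc j" if "j < ?k" for j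
    using r[OF that] inverse_word_nth[OF \<rho>] that by simp
  have g: "g j < length \<alpha>" "\<alpha> ! f (r j) = Suc (g j)" if "j < ?k" for j
    using perm_word_nth[OF \<alpha> f(1)[OF r(1)[OF that]]] by (auto simp: g_def)
  have \<alpha>g: "inverse_word \<alpha> ! g j = Suc (f (r j))" if "j < ?k" for j
    using g[OF that] inverse_word_nth[OF \<alpha>] f(1)[OF r(1)[OF that]] by simp
  have "f i < f j \<longleftrightarrow> i < j" if "i < ?k" "j < ?k" for i j
    using f(2)[of i j] f(2)[of j i] that by (metis less_asym linorder_less_linear)
  then have "inverse_word \<alpha> ! g i < inverse_word \<alpha> ! g j \<longleftrightarrow> inverse_word \<rho> ! i < inverse_word \<rho> ! j"
    if "i < ?k" "j < ?k" for i j
    using that r \<alpha>g by simp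
  moreover have "g i < g j" if "i < j" "j < ?k" for i j
    using f(3)[of "r i" "r j"] r(1)[of i] r(1)[of j] \<rho>r[of i] \<rho>r[of j] g[of i] g[of j] that by simp
  ultimately show ?thesis
    unfolding contains_pattern_iff_nth using g(1) by (intro exI[of _ g]) simp
qed

lemma contains_inverse_word_iff:
  assumes "perm_word \<alpha>" "perm_word \<rho>"
  shows "contains_pattern (inverse_word \<alpha>) (inverse_word \<rho>) \<longleftrightarrow> contains_pattern \<alpha> \<rho>"
  using contains_pattern_inverse_word[OF assms]
    contains_pattern_inverse_word[OF assms[THEN perm_word_inverse_word]] assms
  by auto

lemma perm_word_132 [simp]: "perm_word [1, 3, 2]"
  by (intro perm_wordI) auto

lemma inverse_word_132 [simp]: "inverse_word [1, 3, 2] = [1, 3, 2]"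
  by (rule inverse_word_eqI[OF perm_word_132]) (auto simp: less_Suc_eq numeral_3_eq_3 numeral_2_eq_2)

lemma perm_word_upt: "perm_word [1..<Suc m]"
  by (auto simp: perm_word_def)

lemma inverse_word_upt: "inverse_word [1..<Suc m] = [1..<Suc m]"
  by (rule inverse_word_eqI[OF perm_word_upt]) (simp_all del: upt_Suc)

lemma upt_eq_add_top: "[1..<Suc (Suc m)] = add_top [1..<Suc m]"
  by (simp add: add_top_def)

section \<open>Permutations in one-line notation as words\<close>

lemma length_one_line [simp]: "length (one_line n \<pi>) = n"
  by (simp add: one_line_def del: upt_Suc)

lemma one_line_nth: "i < n \<Longrightarrow> one_line n \<pi> ! i = \<pi> (Suc i)"
  by (simp add: one_line_def del: upt_Suc)

lemma perm_word_one_line: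
  assumes "\<pi> permutes {1..n}"
  shows "perm_word (one_line n \<pi>)"
  unfolding perm_word_def
proof
  show "distinct (one_line n \<pi>)"
    using permutes_inj_on[OF assms] by (simp add: one_line_def distinct_map del: upt_Suc)
  show "set (one_line n \<pi>) = {1..length (one_line n \<pi>)}"
    using permutes_image[OF assms] by (simp add: one_line_def atLeastLessThanSuc_atLeastAtMost del: upt_Suc)
qed

lemma inverse_word_one_line:
  assumes "\<pi> permutes {1..n}"
  shows "inverse_word (one_line n \<pi>) = one_line n (inv \<pi>)"
  by (rule inverse_word_eqI)
    (use assms in \<open>auto simp: perm_word_one_line one_line_nth permutes_inverses(2) dest: sym\<close>)

lemma one_line_inject:
  assumes "\<pi> permutes {1..n}" "\<pi>' permutes {1..n}" "one_line n \<pi> = one_line n \<pi>'"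
  shows "\<pi> = \<pi>'"
proof
  fix x
  show "\<pi> x = \<pi>' x"
  proof (cases "x \<in> {1..n}")
    case True
    then have "one_line n \<pi> ! (x - 1) = one_line n \<pi>' ! (x - 1)" by (simp add: assms(3))
    moreover have "x - 1 < n" "Suc (x - 1) = x" using True by auto
    ultimately show ?thesis by (simp only: one_line_nth)
  qed (use assms in \<open>simp add: permutes_not_in\<close>)
qed

lemma one_line_surj:
  assumes "perm_word w"
  obtains \<pi> where "\<pi> permutes {1..length w}" "one_line (length w) \<pi> = w"
proof -
  define \<pi> where "\<pi> x = (if x \<in> {1..length w} then w ! (x - 1) else x)" for x
  have eq: "one_line (length w) \<pi> = w" by (rule nth_equalityI) (simp_all add: one_line_nth \<pi>_def)
  have "bij_betw \<pi> {1..length w} {1..length w}"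
    unfolding bij_betw_def
  proof
    have "map \<pi> [1..<Suc (length w)] = w" using eq by (simp add: one_line_def del: upt_Suc)
    then have "\<pi> ` set [1..<Suc (length w)] = set w" "distinct (map \<pi> [1..<Suc (length w)])"
      using assms by (metis list.set_map, simp add: perm_word_def del: upt_Suc)
    then show "inj_on \<pi> {1..length w}" "\<pi> ` {1..length w} = {1..length w}"
      using assms by (simp_all add: distinct_map perm_word_def atLeastLessThanSuc_atLeastAtMost del: upt_Suc)
  qed
  then have "\<pi> permutes {1..length w}" by (rule bij_imp_permutes) (auto simp: \<pi>_def)
  with eq that show thesis by blast
qed

section \<open>Decomposition of 132-avoiding words\<close>

lemma avoids_132_skew_sum_iff:
  assumes "perm_word A" "perm_word B"
  shows "avoids_pattern (A \<ominus> B) [1, 3, 2] \<longleftrightarrow> avoids_pattern A [1, 3, 2] \<and> avoids_pattern B [1, 3, 2]"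
  using contains_skew_sum_indecomposable[OF assms skew_indecomposable_132]
  by (auto simp: avoids_pattern_def)

lemma avoids_132_add_top_iff:
  assumes "perm_word A"
  shows "avoids_pattern (add_top A) [1, 3, 2] \<longleftrightarrow> avoids_pattern A [1, 3, 2]"
  using contains_add_top_iff[OF assms, of 3 "[1, 3, 2]"] by (simp add: avoids_pattern_def)

lemma avoids_132_inverse_word_iff:
  assumes "perm_word A"
  shows "avoids_pattern (inverse_word A) [1, 3, 2] \<longleftrightarrow> avoids_pattern A [1, 3, 2]"
  using contains_inverse_word_iff[OF assms perm_word_132] by (simp only: avoids_pattern_def inverse_word_132)

text \<open>Cut after the maximum n. If some x before n were smaller than some y after it, then x,
  n, y would form 132; hence everything up to n lies above everything after it.\<close>

lemma avoids_132_decompose: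
  assumes w: "perm_word w" "w \<noteq> []" and av: "avoids_pattern w [1, 3, 2]"
  obtains A B where "perm_word A" "perm_word B" "w = add_top A \<ominus> B"
proof -
  let ?n = "length w"
  have "?n \<in> set w" using w by (simp add: perm_word_def Suc_le_eq)
  then obtain X Y where XY: "w = X @ ?n # Y" by (metis split_list)
  have "distinct (X @ ?n # Y)" using w(1) XY unfolding perm_word_def by metis
  moreover have "y \<in> set w" if "y \<in> set Y" for y using that by (subst XY) simp
  ultimately have less_aux: "?n \<notin> set Y" "set X \<inter> set Y = {}" "\<And>y. y \<in> set Y \<Longrightarrow> y \<le> ?n"
    using perm_word_le[OF w(1)] by auto
  have less: "y < x" if "x \<in> set X" "y \<in> set Y" for x y
  proof (rule ccontr)
    assume "\<not> y < x"
    moreover have "x \<noteq> y" "y \<noteq> ?n" "y \<le> ?n"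
      using less_aux that by auto
    ultimately have "order_isomorphic [x, ?n, y] [1, 3, 2]"
      by (auto simp: order_isomorphic_def less_Suc_eq numeral_3_eq_3)
    moreover have "subseq [x, ?n, y] w"
    proof -
      have "subseq ([x] @ ?n # [y]) (X @ ?n # Y)"
        using that by (intro list_emb_append_mono) (auto simp: subseq_singleton_left)
      then show ?thesis using XY by simp
    qed
    ultimately show False using av by (auto simp: avoids_pattern_def contains_pattern_def)
  qed
  have "y < x" if "x \<in> set (X @ [?n])" "y \<in> set Y" for x y
  proof (cases "x = ?n")
    case True
    then show ?thesis using less_aux that(2) by (metis le_neq_implies_less)
  qed (use less that in auto)
  moreover have "perm_word ((X @ [?n]) @ Y)" using w(1) XY by simp
  ultimately obtain U where U: "perm_word U" "perm_word Y" "(X @ [?n]) @ Y = U \<ominus> Y"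
    by (metis perm_word_append_skew)
  then have XU: "X @ [?n] = map (\<lambda>x. x + length Y) U" by (simp add: skew_sum_def)
  then obtain A z where A: "U = A @ [z]" "?n = z + length Y" "X = map (\<lambda>x. x + length Y) A"
    by (auto simp: append_eq_map_conv)
  moreover have "?n = length A + 1 + length Y" using arg_cong[OF XY, of length] A(3) by simp
  ultimately have "U = add_top A" by (simp add: add_top_def)
  then show thesis using that[of A Y] U XY perm_word_add_topD by simp
qed

text \<open>If the first blocks had different lengths, the shorter would split off the longer, which
  ends in its maximum. The fact \<open>le\<close> says this one-sidedly; applied in both directions
  it gives equal lengths.\<close>

lemma add_top_skew_sum_inject:
  assumes p: "perm_word A" "perm_word B" "perm_word C" "perm_word D"
    and eq: "add_top A \<ominus> B = add_top C \<ominus> D"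
  shows "A = C" "B = D"
proof -
  have le: "length C \<le> length A"
    if h: "perm_word A" "perm_word B" "perm_word C" "perm_word D"
      "add_top A \<ominus> B = add_top C \<ominus> D" "length A \<le> length C" for A B C D
  proof -
    obtain E where "perm_word E" "add_top C = add_top A \<ominus> E"
      by (rule skew_sum_eq_skew_sum[of "add_top A" B "add_top C" D])
        (use h perm_word_add_top in auto)
    then have "E = []" using add_top_eq_skew_sum[of "add_top A" E C] h(1) perm_word_add_top
      by (auto simp: add_top_def)
    then show ?thesis using \<open>add_top C = add_top A \<ominus> E\<close> by simp
  qed
  have "length A = length C"
    using le[OF p eq] le[OF p(3,4,1,2) eq[symmetric]] by linarith
  then show "A = C" "B = D" using skew_sum_cancel[OF eq] by auto
qed

section \<open>Counting 132-avoiding words\<close>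

definition words_132 :: "nat \<Rightarrow> nat list set" where
  "words_132 n = {w. perm_word w \<and> length w = n \<and> avoids_pattern w [1, 3, 2]}"

definition word_gf :: "nat list \<Rightarrow> real fps" where
  "word_gf \<rho> = Abs_fps (\<lambda>n. of_nat (card {w \<in> words_132 n. avoids_pattern w \<rho>}))"

lemma finite_words_132 [simp]: "finite (words_132 n)"
  unfolding words_132_def by (rule finite_perm_words)

lemma words_132_0 [simp]: "words_132 0 = {[]}"
  by (auto simp: words_132_def avoids_pattern_def)

text \<open>Every word, even the empty one, contains the empty pattern. The value 0 agrees with
  \<open>cheb_num 0\<close> and starts all inductions on wedge patterns.\<close>

lemma word_gf_Nil: "word_gf [] = 0"
  by (rule fps_ext) (simp add: word_gf_def avoids_pattern_def)

text \<open>The index i is the number of entries before the maximum. \<open>P\<close> stays a joint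
  condition on the pair, because for a wedge pattern the condition on B depends on A.\<close>

lemma card_words_132_Suc:
  "card {w \<in> words_132 (Suc n). P w} =
     (\<Sum>i\<le>n. card {(A, B) \<in> words_132 i \<times> words_132 (n - i). P (add_top A \<ominus> B)})"
proof -
  define S where "S i = {(A, B) \<in> words_132 i \<times> words_132 (n - i). P (add_top A \<ominus> B)}" for i
  let ?f = "\<lambda>(A, B). add_top A \<ominus> B"
  have fin: "finite (S i)" for i
    by (rule finite_subset[of _ "words_132 i \<times> words_132 (n - i)"]) (auto simp: S_def)
  have "{w \<in> words_132 (Suc n). P w} = ?f ` (\<Union>i\<le>n. S i)"
  proof (intro equalityI subsetI)
    fix w assume "w \<in> {w \<in> words_132 (Suc n). P w}"
    then have w: "perm_word w" "length w = Suc n" "avoids_pattern w [1, 3, 2]" "P w"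
      by (auto simp: words_132_def)
    have "w \<noteq> []" using w(2) by auto
    obtain A B where AB: "perm_word A" "perm_word B" "w = add_top A \<ominus> B"
      by (rule avoids_132_decompose[OF w(1) \<open>w \<noteq> []\<close> w(3)])
    then have "(A, B) \<in> S (length A)"
      using w avoids_132_skew_sum_iff[of "add_top A" B] avoids_132_add_top_iff[of A]
      by (auto simp: S_def words_132_def perm_word_add_top)
    moreover have "length A \<le> n" using w(2) AB(3) by simp
    ultimately show "w \<in> ?f ` (\<Union>i\<le>n. S i)" using AB(3) by (auto intro!: rev_image_eqI)
  next
    fix w assume "w \<in> ?f ` (\<Union>i\<le>n. S i)"
    then obtain i A B where "i \<le> n" "(A, B) \<in> S i" "w = add_top A \<ominus> B" by auto
    then show "w \<in> {w \<in> words_132 (Suc n). P w}"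
      using avoids_132_skew_sum_iff[of "add_top A" B] avoids_132_add_top_iff[of A]
      by (auto simp: S_def words_132_def perm_word_add_top perm_word_skew_sum)
  qed
  moreover have "inj_on ?f (\<Union>i\<le>n. S i)"
  proof (rule inj_onI)
    fix p q assume pq: "p \<in> (\<Union>i\<le>n. S i)" "q \<in> (\<Union>i\<le>n. S i)" "?f p = ?f q"
    obtain A B C D where eq: "p = (A, B)" "q = (C, D)" by (cases p, cases q)
    have "perm_word A" "perm_word B" "perm_word C" "perm_word D"
      using pq(1,2) by (auto simp: eq S_def words_132_def)
    then show "p = q" using add_top_skew_sum_inject[of A B C D] pq(3) by (simp add: eq)
  qed
  ultimately have "card {w \<in> words_132 (Suc n). P w} = card (\<Union>i\<le>n. S i)"
    by (simp add: card_image)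
  also have "\<dots> = (\<Sum>i\<le>n. card (S i))"
    by (rule card_UN_disjoint) (use fin in \<open>auto simp: S_def words_132_def\<close>)
  finally show ?thesis by (simp add: S_def)
qed

text \<open>Of the three alternatives for a skew sum of two indecomposable patterns, the occurrence
  in A followed by its maximum still has to be reduced to A. This depends on whether w ends in its
  maximum, that is, on whether t = 0.\<close>

lemma contains_wedge_step_iff:
  assumes "perm_word A" "perm_word B" "perm_word u"
    and w: "w = add_top u \<ominus> [1..<Suc t]"
  shows "contains_pattern (add_top A \<ominus> B) w \<longleftrightarrow>
    contains_pattern A w \<or> contains_pattern B w \<or> contains_pattern A u \<and> contains_pattern B [1..<Suc t]"
proof -
  have T: "skew_indecomposable [1..<Suc t]"
  proof (cases t)
    case (Suc m)
    then show ?thesis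
      using skew_indecomposable_add_top[OF perm_word_upt[of m]] by (simp only: upt_eq_add_top)
  qed simp
  have u: "contains_pattern C u" if "contains_pattern C w" for C
    using that contains_skew_sumD(1) contains_add_topD unfolding w by blast
  have "contains_pattern (add_top A) w \<longleftrightarrow> contains_pattern A w" if "t > 0"
  proof (rule contains_add_top_iff[OF assms(1), of "length w"])
    show "length w \<in> set w" by (auto simp: w skew_sum_def add_top_def simp del: upt_Suc)
    show "last w < length w" using that by (simp add: w skew_sum_def)
  qed
  \<comment> \<open>Here containing u already suffices for A. The common formula remains valid,
    since every B contains the empty pattern \<open>[1..<Suc 0]\<close>.\<close>
  moreover have "contains_pattern (add_top A) w \<longleftrightarrow> contains_pattern A u" if "t = 0"
    using contains_add_top_add_top[OF assms(1,3)] that by (simp add: w)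
  moreover have "contains_pattern (add_top A \<ominus> B) w \<longleftrightarrow>
      contains_pattern (add_top A) w \<or> contains_pattern B w \<or>
      contains_pattern A u \<and> contains_pattern B [1..<Suc t]"
    using contains_skew_sum_skew_sum[of "add_top A" B "add_top u" "[1..<Suc t]"] assms(1-3) T
      skew_indecomposable_add_top perm_word_add_top perm_word_upt contains_add_top_add_top
    unfolding w by metis
  ultimately show ?thesis using u by (cases "t = 0") auto
qed

text \<open>If A avoids u, then B only has to avoid w: this gives F_u F. If A avoids w but contains
  u, then B has to avoid 12...t, which implies that it avoids w: this gives (F - F_u) F_t. The
  summand 1 is the empty word.\<close>

lemma word_gf_wedge_step:
  assumes u: "perm_word u" and w: "w = add_top u \<ominus> [1..<Suc t]"
  defines "T \<equiv> [1..<Suc t]"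
  shows "word_gf w = 1 + fps_X * (word_gf u * word_gf w + (word_gf w - word_gf u) * word_gf T)"
proof (rule fps_ext)
  fix n
  define X where "X \<rho> i = {A \<in> words_132 i. avoids_pattern A \<rho>}" for \<rho> i
  have nth: "word_gf \<rho> $ i = card (X \<rho> i)" for \<rho> i by (simp add: word_gf_def X_def)
  have fin [simp]: "finite (X \<rho> i)" for \<rho> i by (simp add: X_def)
  have "contains_pattern A u" if "contains_pattern A w" for A
    using that contains_skew_sumD(1) contains_add_topD unfolding w by blast
  then have sub: "X u i \<subseteq> X w i" for i by (auto simp: X_def avoids_pattern_def)
  have "w \<noteq> []" by (auto simp: w skew_sum_def add_top_def)
  then have X0: "X w 0 = {[]}" by (auto simp: X_def avoids_pattern_def)
  show "word_gf w $ n = (1 + fps_X * (word_gf u * word_gf w + (word_gf w - word_gf u) * word_gf T)) $ n"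
  proof (cases n)
    case 0
    then show ?thesis by (simp add: nth X0)
  next
    case (Suc m)
    have "real (card {(A, B) \<in> words_132 i \<times> words_132 (m - i). avoids_pattern (add_top A \<ominus> B) w}) =
        word_gf u $ i * word_gf w $ (m - i) + (word_gf w $ i - word_gf u $ i) * word_gf T $ (m - i)" for i
    proof -
      have "{(A, B) \<in> words_132 i \<times> words_132 (m - i). avoids_pattern (add_top A \<ominus> B) w} =
          X u i \<times> X w (m - i) \<union> (X w i - X u i) \<times> X T (m - i)" (is "?S = _")
      proof (rule set_eqI, clarify)
        fix A B
        show "(A, B) \<in> ?S \<longleftrightarrow> (A, B) \<in> X u i \<times> X w (m - i) \<union> (X w i - X u i) \<times> X T (m - i)"
        proof (cases "A \<in> words_132 i \<and> B \<in> words_132 (m - i)")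
          case True
          then have "perm_word A" "perm_word B" by (simp_all add: words_132_def)
          have *: "contains_pattern C u" "contains_pattern C T" if "contains_pattern C w" for C
            using that contains_skew_sumD contains_add_topD unfolding w T_def by blast+
          show ?thesis
            using contains_wedge_step_iff[OF \<open>perm_word A\<close> \<open>perm_word B\<close> u w] True *
            unfolding T_def[symmetric] by (auto simp: X_def avoids_pattern_def)
        qed (auto simp: X_def)
      qed
      moreover have "card (X u i \<times> X w (m - i) \<union> (X w i - X u i) \<times> X T (m - i)) =
          card (X u i) * card (X w (m - i)) + (card (X w i) - card (X u i)) * card (X T (m - i))"
        by (subst card_Un_disjoint) (auto simp: card_cartesian_product card_Diff_subset sub)
      moreover have "card (X u i) \<le> card (X w i)" by (intro card_mono sub) simp
      ultimately show ?thesis by (simp add: nth of_nat_diff)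
    qed
    then have "word_gf w $ Suc m = (\<Sum>i\<le>m. word_gf u $ i * word_gf w $ (m - i) +
        (word_gf w $ i - word_gf u $ i) * word_gf T $ (m - i))"
      unfolding word_gf_def[of w] fps_nth_Abs_fps card_words_132_Suc by simp
    moreover have "(1 + fps_X * G) $ Suc m = G $ m" for G :: "real fps" by simp
    ultimately show ?thesis
      by (simp only: Suc) (simp add: fps_mult_nth sum.distrib atMost_atLeast0)
  qed
qed

section \<open>132-avoiding involutions\<close>

text \<open>With E an involution these are the involutions that do not end in their maximum; with E
  empty the same construction yields the double-wedge patterns.\<close>

definition skew_square :: "nat list \<Rightarrow> nat list \<Rightarrow> nat list" where
  "skew_square A E = add_top A \<ominus> E \<ominus> add_top (inverse_word A)"

definition involutions_132 :: "nat \<Rightarrow> nat list set" where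
  "involutions_132 n = {w \<in> words_132 n. inverse_word w = w}"

lemma length_skew_square: "length (skew_square A E) = 2 * length A + length E + 2"
  by (simp add: skew_square_def)

lemma perm_word_skew_square:
  "perm_word A \<Longrightarrow> perm_word E \<Longrightarrow> perm_word (skew_square A E)"
  by (simp add: skew_square_def perm_word_skew_sum perm_word_add_top perm_word_inverse_word)

lemma inverse_word_skew_square:
  "perm_word A \<Longrightarrow> perm_word E \<Longrightarrow> inverse_word (skew_square A E) = skew_square A (inverse_word E)"
  by (simp add: skew_square_def perm_word_skew_sum perm_word_add_top perm_word_inverse_word
      inverse_word_skew_sum inverse_word_add_top skew_sum_assoc)

lemma avoids_132_skew_square_iff:
  "perm_word A \<Longrightarrow> perm_word E \<Longrightarrow> avoids_pattern (skew_square A E) [1, 3, 2] \<longleftrightarrow>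
    avoids_pattern A [1, 3, 2] \<and> avoids_pattern E [1, 3, 2]"
  using avoids_132_inverse_word_iff
  by (auto simp only: skew_square_def perm_word_skew_sum perm_word_add_top perm_word_inverse_word
      avoids_132_skew_sum_iff avoids_132_add_top_iff)

lemma skew_square_inject:
  assumes p: "perm_word A" "perm_word E" "perm_word A'" "perm_word E'"
    and eq: "skew_square A E = skew_square A' E'"
  shows "A = A'" "E = E'"
proof -
  let ?i = "\<lambda>A. add_top (inverse_word A)"
  have i: "perm_word (?i A)" "perm_word (?i A')"
    using p by (simp_all add: perm_word_add_top perm_word_inverse_word)
  have eq': "add_top A \<ominus> (E \<ominus> ?i A) = add_top A' \<ominus> (E' \<ominus> ?i A')"
    using eq by (simp add: skew_square_def)
  show A: "A = A'"
    by (rule add_top_skew_sum_inject(1)[OF p(1) _ p(3) _ eq']) (use p i in \<open>simp_all add: perm_word_skew_sum\<close>)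
  have "E \<ominus> ?i A = E' \<ominus> ?i A"
    using add_top_skew_sum_inject(2)[OF p(1) _ p(3) _ eq'] p i A by (simp add: perm_word_skew_sum)
  moreover from this have "length E = length E'" by (auto dest: arg_cong[of _ _ length])
  ultimately show "E = E'" by (rule skew_sum_cancel(1))
qed

text \<open>
  Comparing \<open>w = add_top A \<ominus> B\<close> with its inverse \<open>inverse_word B \<ominus> add_top (inverse_word A)\<close>,
  the shorter of the two first blocks splits off the longer one.
\<close>

lemma involution_decompose:
  assumes w: "perm_word w" "w \<noteq> []" and av: "avoids_pattern w [1, 3, 2]" and inv: "inverse_word w = w"
  obtains (top) A where "perm_word A" "inverse_word A = A" "w = add_top A"
  | (square) A E where "perm_word A" "perm_word E" "inverse_word E = E" "w = skew_square A E"
proof -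
  obtain A B where p: "perm_word A" "perm_word B" and wAB: "w = add_top A \<ominus> B"
    by (rule avoids_132_decompose[OF w av])
  let ?i = "add_top (inverse_word A)"
  have pA: "perm_word (add_top A)" "perm_word ?i" and pB: "perm_word (inverse_word B)"
    and iA: "inverse_word (add_top A) = ?i" "inverse_word ?i = add_top A"
    using p by (simp_all add: perm_word_add_top perm_word_inverse_word inverse_word_add_top)
  have eq: "add_top A \<ominus> B = inverse_word B \<ominus> ?i"
    using inv inverse_word_skew_sum[OF pA(1) p(2)] iA by (simp add: wAB)
  show thesis
  proof (cases "length (add_top A) \<le> length B")
    case True
    then have "length (add_top A) \<le> length (inverse_word B)" by simp
    then obtain E where E: "perm_word E" "inverse_word B = add_top A \<ominus> E" "B = E \<ominus> ?i"
      by (rule skew_sum_eq_skew_sum[OF pA(1) p(2) pB pA(2) eq])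
    \<comment> \<open>The inverse of B is known from the refinement and can also be computed from B
      = E \<ominus> \<open>?i\<close>; comparing the two shows that E is its own inverse.\<close>
    have "add_top A \<ominus> inverse_word E = add_top A \<ominus> E"
      using E(2) inverse_word_skew_sum[OF E(1) pA(2)] iA by (simp add: E(3))
    then have "inverse_word E = E" using skew_sum_cancel(2)[OF _ refl] by blast
    then show thesis using square[OF p(1) E(1)] by (simp add: wAB E(3) skew_square_def)
  next
    case False
    then have "length (inverse_word B) \<le> length (add_top A)" by simp
    then obtain E where E: "perm_word E" "add_top A = inverse_word B \<ominus> E"
      by (rule skew_sum_eq_skew_sum[OF pB pA(2) pA(1) p(2) eq[symmetric]])
    \<comment> \<open>A word ending in its maximum does not split. An empty E would make both first
      blocks equally long, against the case assumption, so B is empty.\<close>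
    then have "inverse_word B = [] \<or> E = []" using add_top_eq_skew_sum pB by blast
    then have "length B = 0"
      using E(2) False by (metis length_inverse_word list.size(3) order_refl skew_sum_Nil(1))
    then have B: "B = []" by simp
    then show thesis using top[OF p(1)] eq by (simp add: wAB)
  qed
qed

section \<open>Counting 132-avoiding involutions\<close>

lemma finite_involutions_132 [simp]: "finite (involutions_132 n)"
  by (simp add: involutions_132_def)

lemma involutions_132_0 [simp]: "involutions_132 0 = {[]}"
  by (auto simp: involutions_132_def)

lemma add_top_neq_skew_square:
  assumes "perm_word A" "perm_word E"
  shows "add_top C \<noteq> skew_square A E"
proof
  assume "add_top C = skew_square A E"
  then have "add_top A = [] \<or> E \<ominus> add_top (inverse_word A) = []"
    unfolding skew_square_def
    by (rule add_top_eq_skew_sum[rotated 2])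
      (use assms in \<open>simp_all add: perm_word_skew_sum perm_word_add_top perm_word_inverse_word\<close>)
  then show False by (auto dest: arg_cong[of _ _ length])
qed

text \<open>A and its inverse together contribute 2|A| entries. Indexing by i = 2|A| makes these
  numbers the coefficients of a series in x^2.\<close>

lemma card_even_square_words:
  "card {A. perm_word A \<and> 2 * length A = i \<and> avoids_pattern A [1, 3, 2] \<and> P A} =
    (if even i then card {A \<in> words_132 (i div 2). P A} else 0)"
proof (cases "even i")
  case True
  then have "{A. perm_word A \<and> 2 * length A = i \<and> avoids_pattern A [1, 3, 2] \<and> P A} =
      {A \<in> words_132 (i div 2). P A}"
    by (auto simp: words_132_def)
  then show ?thesis using True by simp
next
  case False
  then have "{A. perm_word A \<and> 2 * length A = i \<and> avoids_pattern A [1, 3, 2] \<and> P A} = {}" by auto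
  then show ?thesis using False by (simp only: card.empty if_False)
qed

text \<open>A skew square of length n + 1 has 2|A| + |E| + 2 = n + 1, so i = 2|A| leaves n - 1 - i
  entries for E. For n = 0 the sum is empty and the truncated subtraction does no harm.\<close>

lemma card_involutions_132_Suc:
  assumes sq: "\<And>A E. perm_word A \<Longrightarrow> perm_word E \<Longrightarrow> P (skew_square A E) \<longleftrightarrow> G A \<and> P E"
  shows "card {w \<in> involutions_132 (Suc n). P w} =
    card {A \<in> involutions_132 n. P (add_top A)} +
    (\<Sum>i<n. (if even i then card {A \<in> words_132 (i div 2). G A} else 0) *
        card {E \<in> involutions_132 (n - 1 - i). P E})"
proof -
  define S where "S i = {A. perm_word A \<and> 2 * length A = i \<and> avoids_pattern A [1, 3, 2] \<and> G A} \<times>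
      {E \<in> involutions_132 (n - 1 - i). P E}" for i
  let ?f = "\<lambda>(A, E). skew_square A E"
  let ?T = "{A \<in> involutions_132 n. P (add_top A)}"
  have cardS: "card (S i) = (if even i then card {A \<in> words_132 (i div 2). G A} else 0) *
        card {E \<in> involutions_132 (n - 1 - i). P E}" for i
    by (simp only: S_def card_cartesian_product card_even_square_words)
  have perm: "perm_word A" "perm_word E" if "(A, E) \<in> S i" for A E i
    using that by (auto simp: S_def involutions_132_def words_132_def)
  have finS: "finite (S i)" for i
    unfolding S_def
  proof (rule finite_cartesian_product)
    show "finite {A. perm_word A \<and> 2 * length A = i \<and> avoids_pattern A [1, 3, 2] \<and> G A}"
      by (rule finite_subset[OF _ finite_words_132[of "i div 2"]]) (auto simp: words_132_def)
  qed simp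
  have eq: "{w \<in> involutions_132 (Suc n). P w} = add_top ` ?T \<union> ?f ` (\<Union>i<n. S i)"
  proof (intro equalityI subsetI)
    fix w assume "w \<in> {w \<in> involutions_132 (Suc n). P w}"
    then have w: "perm_word w" "length w = Suc n" "avoids_pattern w [1, 3, 2]" "inverse_word w = w" "P w"
      by (auto simp: involutions_132_def words_132_def)
    have "w \<noteq> []" using w(2) by auto
    show "w \<in> add_top ` ?T \<union> ?f ` (\<Union>i<n. S i)"
    proof (rule involution_decompose[OF w(1) \<open>w \<noteq> []\<close> w(3,4)])
      fix A assume A: "perm_word A" "inverse_word A = A" "w = add_top A"
      then have "A \<in> ?T"
        using w avoids_132_add_top_iff[OF A(1)] by (simp add: involutions_132_def words_132_def)
      then show ?thesis using A(3) by blast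
    next
      fix A E assume A: "perm_word A" "perm_word E" "inverse_word E = E" "w = skew_square A E"
      then have "2 * length A + length E + 1 = n" using w(2) by (simp add: length_skew_square)
      then have "(A, E) \<in> S (2 * length A)" "2 * length A < n"
        using A w(3,5) sq avoids_132_skew_square_iff
        by (auto simp: S_def involutions_132_def words_132_def)
      then have "(A, E) \<in> (\<Union>i<n. S i)" by blast
      then show ?thesis using A(4) by (intro UnI2 rev_image_eqI[of "(A, E)"]) simp_all
    qed
  next
    fix w assume "w \<in> add_top ` ?T \<union> ?f ` (\<Union>i<n. S i)"
    then consider A where "A \<in> ?T" "w = add_top A" | i A E where "i < n" "(A, E) \<in> S i" "w = skew_square A E"
      by auto
    then show "w \<in> {w \<in> involutions_132 (Suc n). P w}"
    proof cases
      case 1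
      then show ?thesis
        using avoids_132_add_top_iff[of A]
        by (simp add: involutions_132_def words_132_def perm_word_add_top inverse_word_add_top)
    next
      case 2
      note p = perm[OF 2(2)]
      show ?thesis
        using 2 p avoids_132_skew_square_iff[OF p] sq[OF p] length_skew_square[of A E]
        by (simp add: involutions_132_def words_132_def S_def perm_word_skew_square inverse_word_skew_square)
    qed
  qed
  have inj: "inj_on ?f (\<Union>i<n. S i)"
  proof (rule inj_onI)
    fix p q assume pq: "p \<in> (\<Union>i<n. S i)" "q \<in> (\<Union>i<n. S i)" "?f p = ?f q"
    obtain A B C D where e: "p = (A, B)" "q = (C, D)" by (cases p, cases q)
    have "perm_word A" "perm_word B" "perm_word C" "perm_word D"
      using pq(1,2) perm by (auto simp: e)
    then show "p = q" using skew_square_inject[of A B C D] pq(3) by (simp add: e)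
  qed
  have "card {w \<in> involutions_132 (Suc n). P w} = card (add_top ` ?T) + card (?f ` (\<Union>i<n. S i))"
    unfolding eq
  proof (rule card_Un_disjoint)
    show "add_top ` ?T \<inter> ?f ` (\<Union>i<n. S i) = {}"
      using add_top_neq_skew_square perm by fastforce
  qed (use finS in simp_all)
  also have "card (add_top ` ?T) = card ?T"
    by (rule card_image) (simp add: inj_on_def)
  also have "card (?f ` (\<Union>i<n. S i)) = card (\<Union>i<n. S i)"
    by (rule card_image[OF inj])
  also have "\<dots> = (\<Sum>i<n. card (S i))"
    by (rule card_UN_disjoint) (use finS in \<open>auto simp: S_def\<close>)
  finally show ?thesis by (simp only: cardS)
qed

lemma card_avoiding_involutions:
  "card (avoiding_involutions \<rho> n) = card {w \<in> involutions_132 n. avoids_pattern w \<rho>}"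
proof (rule bij_betw_same_card[of "one_line n"])
  show "bij_betw (one_line n) (avoiding_involutions \<rho> n) {w \<in> involutions_132 n. avoids_pattern w \<rho>}"
    unfolding bij_betw_def
  proof (intro conjI equalityI subsetI)
    show "inj_on (one_line n) (avoiding_involutions \<rho> n)"
      by (rule inj_onI, rule one_line_inject) (auto simp: avoiding_involutions_def)
  next
    fix w assume "w \<in> one_line n ` avoiding_involutions \<rho> n"
    then show "w \<in> {w \<in> involutions_132 n. avoids_pattern w \<rho>}"
      by (auto simp: avoiding_involutions_def involutions_132_def words_132_def perm_word_one_line inverse_word_one_line)
  next
    fix w assume "w \<in> {w \<in> involutions_132 n. avoids_pattern w \<rho>}"
    then have w: "perm_word w" "length w = n" "avoids_pattern w [1, 3, 2]" "inverse_word w = w" "avoids_pattern w \<rho>"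
      by (auto simp: involutions_132_def words_132_def)
    then obtain \<pi> where \<pi>: "\<pi> permutes {1..n}" "one_line n \<pi> = w" by (metis one_line_surj)
    then have "one_line n (inv \<pi>) = one_line n \<pi>" using w(4) inverse_word_one_line[OF \<pi>(1)] by simp
    then have "inv \<pi> = \<pi>" by (rule one_line_inject[OF permutes_inv[OF \<pi>(1)] \<pi>(1)])
    then have "\<pi> \<in> avoiding_involutions \<rho> n" using \<pi> w by (simp add: avoiding_involutions_def)
    then show "w \<in> one_line n ` avoiding_involutions \<rho> n" using \<pi>(2) by blast
  qed
qed

text \<open>A common frame for two uses: for a double-wedge pattern \<open>w'\<close> is w itself,
  and for an increasing pattern \<open>w'\<close> and v are both the increasing pattern with one
  entry less. The factor x^2 counts the two top elements of a skew square.\<close>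

lemma involution_gf_step:
  assumes "w \<noteq> []"
    and top: "\<And>A. perm_word A \<Longrightarrow> contains_pattern (add_top A) w \<longleftrightarrow> contains_pattern A w'"
    and square: "\<And>A E. perm_word A \<Longrightarrow> perm_word E \<Longrightarrow>
      contains_pattern (skew_square A E) w \<longleftrightarrow> contains_pattern A v \<or> contains_pattern E w"
  shows "involution_gf w = 1 + fps_X * involution_gf w' + fps_X\<^sup>2 * (word_gf v oo fps_X\<^sup>2) * involution_gf w"
proof (rule fps_ext)
  fix n
  have nth: "involution_gf \<rho> $ i = card {w \<in> involutions_132 i. avoids_pattern w \<rho>}" for \<rho> i
    by (simp add: involution_gf_def card_avoiding_involutions)
  have v: "(word_gf v oo fps_X\<^sup>2) $ i =
      real (if even i then card {A \<in> words_132 (i div 2). avoids_pattern A v} else 0)" for i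
    by (simp add: fps_nth_compose_X_power word_gf_def)
  show "involution_gf w $ n = (1 + fps_X * involution_gf w' + fps_X\<^sup>2 * (word_gf v oo fps_X\<^sup>2) * involution_gf w) $ n"
  proof (cases n)
    case 0
    have "{u. u = [] \<and> avoids_pattern u w} = {[]}" using assms(1) by (auto simp: avoids_pattern_def)
    then show ?thesis using 0 by (simp add: nth)
  next
    case (Suc m)
    have t: "{A \<in> involutions_132 m. avoids_pattern (add_top A) w} = {A \<in> involutions_132 m. avoids_pattern A w'}"
      using top by (auto simp: avoids_pattern_def involutions_132_def words_132_def)
    have "avoids_pattern (skew_square A E) w \<longleftrightarrow> avoids_pattern A v \<and> avoids_pattern E w"
      if "perm_word A" "perm_word E" for A E
      using square[OF that] by (simp add: avoids_pattern_def)
    note card = card_involutions_132_Suc[of "\<lambda>u. avoids_pattern u w" "\<lambda>u. avoids_pattern u v" m, OF this]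
    have "involution_gf w $ Suc m = involution_gf w' $ m +
        (\<Sum>i<m. (word_gf v oo fps_X\<^sup>2) $ i * involution_gf w $ (m - 1 - i))"
      by (simp add: nth v t card)
    also have "(\<Sum>i<m. (word_gf v oo fps_X\<^sup>2) $ i * involution_gf w $ (m - 1 - i)) =
        (fps_X * ((word_gf v oo fps_X\<^sup>2) * involution_gf w)) $ m"
    proof (cases m)
      case (Suc k)
      have "(fps_X * G) $ Suc k = G $ k" for G :: "real fps" by simp
      then show ?thesis by (simp only: Suc) (simp add: fps_mult_nth lessThan_Suc_atMost atMost_atLeast0)
    qed simp
    finally show ?thesis by (simp add: Suc power2_eq_square mult.assoc)
  qed
qed

section \<open>Wedge patterns\<close>

text \<open>Reads a wedge pattern from its right end: the last layer has the smallest values, hence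
  is 12...t, and the entry before it is the maximum. Steps with t = 0 produce the blocks \<tau> with
  more than one entry.\<close>

inductive iterated_wedge :: "nat list \<Rightarrow> bool" where
  Nil: "iterated_wedge []"
| step: "iterated_wedge u \<Longrightarrow> iterated_wedge (add_top u \<ominus> [1..<Suc t])"

lemma perm_word_iterated_wedge: "iterated_wedge w \<Longrightarrow> perm_word w"
  by (induction rule: iterated_wedge.induct)
    (blast intro: perm_word_Nil perm_word_skew_sum perm_word_add_top perm_word_upt)+

lemma concat_map2_append:
  assumes "length xs = length ys"
  shows "length (concat (map2 (@) xs ys)) = length (concat xs) + length (concat ys)"
    and "set (concat (map2 (@) xs ys)) = set (concat xs) \<union> set (concat ys)"
    and "concat (map2 (@) (map (map f) xs) (map (map f) ys)) = map f (concat (map2 (@) xs ys))"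
  using assms by (induction xs ys rule: list_induct2) auto

lemma map_diff_upt:
  fixes t a b :: nat
  assumes "t \<le> a"
  shows "map (\<lambda>x. x - t) [a..<b] = [a - t..<b - t]"
  using assms by (intro nth_equalityI) auto

text \<open>A form of the layer condition that survives splitting off the last layer and shifting
  the others.\<close>

lemma layered_with_iff:
  "layered_with s \<rho>s \<longleftrightarrow> perm_word (concat \<rho>s) \<and> length (concat \<rho>s) = s \<and>
     (\<forall>\<rho>\<in>set \<rho>s. \<exists>a b. \<rho> = [a..<b]) \<and>
     sorted_wrt (\<lambda>\<rho> \<rho>'. \<forall>x\<in>set \<rho>. \<forall>y\<in>set \<rho>'. y < x) \<rho>s"
proof -
  have "concat \<rho>s \<in> permutations_of_set {1..s} \<longleftrightarrow> perm_word (concat \<rho>s) \<and> length (concat \<rho>s) = s"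
    unfolding permutations_of_set_def perm_word_def
    by (metis (mono_tags, lifting) card_atLeastAtMost diff_Suc_1 distinct_card mem_Collect_eq)
  then show ?thesis by (simp add: layered_with_def sorted_wrt_iff_nth_less) blast
qed

lemma perm_word_upt_eq:
  assumes "perm_word [a..<b]"
  shows "[a..<b] = [1..<Suc (length [a..<b])]"
proof (cases "a < b")
  case True
  have s: "{a..<b} = {1..b - a}" using assms by (simp add: perm_word_def)
  have "a \<in> {1..b - a}" "1 \<in> {a..<b}" using s True by auto
  then have "a = 1" by simp
  then show ?thesis using True by simp
qed simp

text \<open>Remove the last layer, which is an interval and a permutation of 1,...,t, and the
  maximum m before it. Lowering the rest by t gives a wedge word of length m - 1 - t, to which the
  induction hypothesis applies.\<close>

lemma iterated_wedge_concat:
  assumes "length \<tau>s = length \<rho>s" "\<forall>\<tau>\<in>set \<tau>s. \<tau> \<noteq> []" "concat \<tau>s = [Suc s..<Suc m]"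
    and "layered_with s \<rho>s"
  shows "iterated_wedge (concat (map2 (@) \<tau>s \<rho>s))"
  using assms
proof (induction m arbitrary: s \<tau>s \<rho>s rule: less_induct)
  case (less m)
  show ?case
  proof (cases \<tau>s rule: rev_cases)
    case Nil
    then show ?thesis using iterated_wedge.Nil by simp
  next
    case (snoc \<tau>s0 \<tau>)
    then obtain \<rho>s0 \<rho> where \<rho>s: "\<rho>s = \<rho>s0 @ [\<rho>]" and len0: "length \<tau>s0 = length \<rho>s0"
      using less.prems(1) by (cases \<rho>s rule: rev_cases) auto
    define t where "t = length \<rho>"
    have "\<tau> \<noteq> []" using less.prems(2) snoc by simp
    then obtain \<tau>' z where \<tau>: "\<tau> = \<tau>' @ [z]" by (cases \<tau> rule: rev_cases) auto
    have \<tau>s: "concat \<tau>s0 @ \<tau>' @ [z] = [Suc s..<Suc m]" using less.prems(3) snoc \<tau> by simp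
    then have "[Suc s..<Suc m] \<noteq> []" by (metis append_is_Nil_conv list.distinct(1))
    then have sm: "s < m" by (simp del: upt_Suc)
    have z: "z = m" and \<tau>0: "concat \<tau>s0 @ \<tau>' = [Suc s..<m]" using \<tau>s sm by simp_all
    have lay: "perm_word (concat \<rho>s0 @ \<rho>)" "length (concat \<rho>s0 @ \<rho>) = s"
        "\<And>\<rho>'. \<rho>' \<in> set \<rho>s0 \<Longrightarrow> \<exists>a b. \<rho>' = [a..<b]" "\<exists>a b. \<rho> = [a..<b]"
        "sorted_wrt (\<lambda>\<rho> \<rho>'. \<forall>x\<in>set \<rho>. \<forall>y\<in>set \<rho>'. y < x) \<rho>s0"
        "\<And>x y. x \<in> set (concat \<rho>s0) \<Longrightarrow> y \<in> set \<rho> \<Longrightarrow> y < x"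
      using less.prems(4) by (auto simp: layered_with_iff \<rho>s sorted_wrt_append)
    obtain U where U: "perm_word U" "perm_word \<rho>" "concat \<rho>s0 @ \<rho> = U \<ominus> \<rho>"
      by (rule perm_word_append_skew[OF lay(1,6)])
    have \<rho>: "\<rho> = [1..<Suc t]" using perm_word_upt_eq U(2) lay(4) unfolding t_def by metis
    have \<rho>0: "concat \<rho>s0 = map (\<lambda>x. x + t) U" using U(3) by (simp add: skew_sum_def t_def)
    have lU: "length U + t = s" using lay(2) \<rho>0 by (simp add: t_def)
    have gt0: "t < x" if "x \<in> set (concat \<rho>s0)" for x
      using that U(1) unfolding \<rho>0 by (auto simp: perm_word_def)
    \<comment> \<open>Blocks \<tau> must be nonempty: if m was all of the last one, that block
      disappears; otherwise its remainder is kept with an empty layer.\<close>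
    define \<tau>s1 \<rho>s1 where "\<tau>s1 = (if \<tau>' = [] then \<tau>s0 else \<tau>s0 @ [\<tau>'])"
      and "\<rho>s1 = (if \<tau>' = [] then \<rho>s0 else \<rho>s0 @ [[]])"
    have nil: "\<exists>a b. [] = [a..<b :: nat]" by (metis upt_0)
    have len1: "length \<tau>s1 = length \<rho>s1" and c\<tau>: "concat \<tau>s1 = [Suc s..<m]"
      and c\<rho>: "concat \<rho>s1 = concat \<rho>s0" and ne1: "\<forall>\<tau>\<in>set \<tau>s1. \<tau> \<noteq> []"
      and c1: "concat (map2 (@) \<tau>s1 \<rho>s1) = concat (map2 (@) \<tau>s0 \<rho>s0) @ \<tau>'"
      and iv1: "\<forall>\<rho>\<in>set \<rho>s1. \<exists>a b. \<rho> = [a..<b]"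
      and sort1: "sorted_wrt (\<lambda>\<rho> \<rho>'. \<forall>x\<in>set \<rho>. \<forall>y\<in>set \<rho>'. y < x) \<rho>s1"
      using len0 \<tau>0 less.prems(2) snoc lay(3,5) nil
      by (auto simp: \<tau>s1_def \<rho>s1_def sorted_wrt_append)
    \<comment> \<open>All remaining entries exceed t, so this truncated subtraction is undone by
      adding t.\<close>
    define f where "f x = x - t" for x
    let ?u = "concat (map2 (@) (map (map f) \<tau>s1) (map (map f) \<rho>s1))"
    have gt1: "t < x" if "x \<in> set \<rho>'" "\<rho>' \<in> set \<rho>s1" for x \<rho>'
      using gt0[of x] that c\<rho> by (metis UN_I set_concat)
    have "iterated_wedge ?u"
    proof (rule less.IH[of "m - Suc t" _ _ "s - t"])
      show "m - Suc t < m" using sm by simp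
      show "length (map (map f) \<tau>s1) = length (map (map f) \<rho>s1)" using len1 by simp
      show "\<forall>\<tau>\<in>set (map (map f) \<tau>s1). \<tau> \<noteq> []" using ne1 by simp
      have "concat (map (map f) \<tau>s1) = map f [Suc s..<m]" by (simp add: map_concat[symmetric] c\<tau>)
      also have "\<dots> = [Suc s - t..<m - t]" unfolding f_def using lU by (intro map_diff_upt) simp
      also have "\<dots> = [Suc (s - t)..<Suc (m - Suc t)]" using lU sm by (simp add: Suc_diff_le Suc_diff_Suc del: upt_Suc)
      finally show "concat (map (map f) \<tau>s1) = [Suc (s - t)..<Suc (m - Suc t)]" .
      have cU: "concat (map (map f) \<rho>s1) = U"
        by (simp add: map_concat[symmetric] c\<rho> \<rho>0 f_def o_def)
      show "layered_with (s - t) (map (map f) \<rho>s1)"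
        unfolding layered_with_iff cU
      proof (intro conjI ballI)
        show "perm_word U" "length U = s - t" using U(1) lU by simp_all
        fix \<rho>' assume "\<rho>' \<in> set (map (map f) \<rho>s1)"
        then obtain a b where ab: "[a..<b] \<in> set \<rho>s1" "\<rho>' = map f [a..<b]" using iv1 by auto
        \<comment> \<open>An empty layer \<open>[a..<b]\<close> tells nothing about a, so the bound
          on a required by \<open>map_diff_upt\<close> is available only for a < b.\<close>
        show "\<exists>a b. \<rho>' = [a..<b]"
        proof (cases "a < b")
          case True
          then have "t < a" using gt1[of a "[a..<b]"] ab(1) by simp
          then show ?thesis using map_diff_upt[of t a b] ab(2) unfolding f_def by auto
        next
          case False
          then show ?thesis using ab(2) by (intro exI[of _ 0]) simp
        qed
      next
        show "sorted_wrt (\<lambda>\<rho> \<rho>'. \<forall>x\<in>set \<rho>. \<forall>y\<in>set \<rho>'. y < x) (map (map f) \<rho>s1)"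
          unfolding sorted_wrt_map
        proof (rule sorted_wrt_mono_rel[OF _ sort1])
          fix \<rho> \<rho>' assume m: "\<rho> \<in> set \<rho>s1" "\<rho>' \<in> set \<rho>s1"
            and "\<forall>x\<in>set \<rho>. \<forall>y\<in>set \<rho>'. y < x"
          then show "\<forall>x\<in>set (map f \<rho>). \<forall>y\<in>set (map f \<rho>'). y < x"
            using gt1 by (auto simp: f_def intro!: diff_less_mono less_imp_le)
        qed
      qed
    qed
    then have *: "iterated_wedge (add_top ?u \<ominus> [1..<Suc t])" by (rule iterated_wedge.step)
    have "set (concat (map2 (@) \<tau>s1 \<rho>s1)) = set [Suc s..<m] \<union> set (concat \<rho>s0)"
      using concat_map2_append(2)[OF len1] c\<tau> c\<rho> by simp
    then have "x \<in> {Suc s..<m} \<or> x \<in> set (concat \<rho>s0)"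
      if "x \<in> set (concat (map2 (@) \<tau>s1 \<rho>s1))" for x
      using that by (simp del: set_concat)
    then have "t \<le> x" if "x \<in> set (concat (map2 (@) \<tau>s1 \<rho>s1))" for x
      using that gt0[of x] lU by fastforce
    then have "map (\<lambda>x. x + t) ?u = concat (map2 (@) \<tau>s1 \<rho>s1)"
      unfolding concat_map2_append(3)[OF len1] map_map by (intro map_idI) (simp add: f_def)
    moreover have "length ?u = m - Suc s + (s - t)"
      using lU by (simp only: concat_map2_append(3)[OF len1] length_map concat_map2_append(1)[OF len1] c\<tau> c\<rho> \<rho>0)
        simp
    \<comment> \<open>Hence the top added to \<open>?u\<close>, raised by t, is exactly the removed
      entry m.\<close>
    then have "Suc (length ?u) + t = m" using lU sm by simp
    ultimately have "add_top ?u \<ominus> [1..<Suc t] = concat (map2 (@) \<tau>s \<rho>s)"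
      unfolding skew_sum_def add_top_def using \<rho> len0
      by (simp add: snoc \<rho>s \<tau> z c1 del: upt_Suc)
    with * show ?thesis by simp
  qed
qed

lemma iterated_wedge_wedge_word: "wedge_word m w \<Longrightarrow> iterated_wedge w"
  unfolding wedge_word_def by (auto intro: iterated_wedge_concat)

section \<open>Generating functions\<close>

definition cheb_den :: "nat \<Rightarrow> real fps" where
  "cheb_den k = fps_of_poly (chebyshev_P k)"

text \<open>The numerator of R_k. The value 0 at k = 0 corresponds to U_(-1) = 0 and lets the
  recursion of \<open>cheb_den\<close> start at k = 0.\<close>

definition cheb_num :: "nat \<Rightarrow> real fps" where
  "cheb_num k = (if k = 0 then 0 else cheb_den (k - 1))"

lemma cheb_num_0 [simp]: "cheb_num 0 = 0" and cheb_num_Suc [simp]: "cheb_num (Suc k) = cheb_den k"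
  by (simp_all add: cheb_num_def)

lemma cheb_den_0 [simp]: "cheb_den 0 = 1"
  by (simp add: cheb_den_def)

lemma cheb_den_Suc: "cheb_den (Suc k) = cheb_den k - fps_X * cheb_num k"
  by (cases k) (simp_all add: cheb_den_def fps_of_poly_pCons fps_of_poly_diff mult.commute)

lemma cheb_den_nth_0 [simp]: "cheb_den k $ 0 = 1"
  using poly_chebyshev_P_0[of k] by (simp add: cheb_den_def poly_0_coeff_0)

text \<open>This is U_(a+b) = U_a U_b - U_(a-1) U_(b-1) in terms of P_k. The induction moves one
  unit from a to b, which leaves the right-hand side unchanged.\<close>

lemma cheb_den_add: "cheb_den (a + b) = cheb_den a * cheb_den b - fps_X * cheb_num a * cheb_num b"
proof (induction a arbitrary: b)
  case (Suc a)
  from Suc[of "Suc b"] show ?case by (simp add: cheb_den_Suc algebra_simps)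
qed simp

lemma chebyshev_R_mult: "1 \<le> k \<Longrightarrow> chebyshev_R k * cheb_den k = cheb_num k"
  by (simp add: chebyshev_R_quotient fps_divide_unit mult.assoc inverse_mult_eq_1 cheb_num_def
      flip: cheb_den_def)

text \<open>Solve F (1 - x F_u - x F_t) = 1 - x F_u F_t after multiplication by
  \<open>pa * pt\<close>. With \<open>pa\<close>, \<open>qa\<close> standing for P_a, P_(a-1), and
  likewise for t, the addition formula turns the factor of F into P_(a+1+t) and the right-hand side
  into P_(a+t).\<close>

lemma wedge_step_identity:
  fixes x F :: "real fps"
  assumes "F = 1 + x * (Fu * F + (F - Fu) * Ft)" "Fu * pa = qa" "Ft * pt = qt"
  shows "F * ((pa - x * qa) * pt - x * pa * qt) = pa * pt - x * qa * qt"
  using assms by algebra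

lemma word_gf_add_top_skew_sum_upt:
  assumes u: "perm_word u" "word_gf u * cheb_den (length u) = cheb_num (length u)"
    and T: "word_gf [1..<Suc t] * cheb_den t = cheb_num t"
    and w: "w = add_top u \<ominus> [1..<Suc t]"
  shows "word_gf w * cheb_den (length w) = cheb_num (length w)"
proof -
  have l: "length w = Suc (length u) + t" by (simp add: w del: upt_Suc)
  show ?thesis
    using wedge_step_identity[OF word_gf_wedge_step[OF u(1) w] u(2) T]
    unfolding l cheb_den_add by (simp add: cheb_den_Suc cheb_den_add)
qed

text \<open>The increasing pattern arises from steps with t = 0 alone, where F_t = 0. It has to come
  first, because its series is the F_t of the general step.\<close>

lemma word_gf_upt: "word_gf [1..<Suc m] * cheb_den m = cheb_num m"
proof (induction m)
  case 0
  show ?case by (simp add: word_gf_Nil)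
next
  case (Suc m)
  have "word_gf [1..<Suc (Suc m)] * cheb_den (length [1..<Suc (Suc m)]) = cheb_num (length [1..<Suc (Suc m)])"
  proof (rule word_gf_add_top_skew_sum_upt[of "[1..<Suc m]" 0])
    show "[1..<Suc (Suc m)] = add_top [1..<Suc m] \<ominus> [1..<Suc 0]"
      by (simp only: upt_eq_add_top) simp
    show "perm_word [1..<Suc m]" by (rule perm_word_upt)
    show "word_gf [1..<Suc m] * cheb_den (length [1..<Suc m]) = cheb_num (length [1..<Suc m])"
      using Suc by (simp del: upt_Suc)
  qed (simp add: word_gf_Nil)
  then show ?case by (simp del: upt_Suc cheb_num_Suc)
qed

lemma word_gf_iterated_wedge:
  "iterated_wedge w \<Longrightarrow> word_gf w * cheb_den (length w) = cheb_num (length w)"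
proof (induction rule: iterated_wedge.induct)
  case Nil
  show ?case by (simp add: word_gf_Nil)
next
  case (step u t)
  then show ?case
    by (intro word_gf_add_top_skew_sum_upt[OF _ _ word_gf_upt refl] perm_word_iterated_wedge)
qed

section \<open>Involutions avoiding a pattern \<open>skew_square v []\<close>\<close>

text \<open>Inversion permutes the 132-avoiding words, as 132 is its own inverse. This makes the two
  forms of a double-wedge pattern equivalent for counting.\<close>

lemma word_gf_inverse_word:
  assumes v: "perm_word v"
  shows "word_gf (inverse_word v) = word_gf v"
proof (rule fps_ext)
  fix n
  have "bij_betw inverse_word {w \<in> words_132 n. avoids_pattern w (inverse_word v)}
      {w \<in> words_132 n. avoids_pattern w v}"
    by (rule bij_betw_byWitness[where f' = inverse_word])
      (use contains_inverse_word_iff[OF _ v] contains_inverse_word_iff[OF _ perm_word_inverse_word[OF v]]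
        avoids_132_inverse_word_iff v in \<open>auto simp: words_132_def perm_word_inverse_word avoids_pattern_def\<close>)
  then show "word_gf (inverse_word v) $ n = word_gf v $ n"
    by (simp add: word_gf_def bij_betw_same_card)
qed

text \<open>An occurrence not inside E places v with its top in the first block or the inverse of v
  with its top in the last one, and either means that A contains v. Conversely, if A contains v, the
  two outer blocks together contain the whole pattern.\<close>

lemma contains_skew_square_skew_square:
  assumes p: "perm_word A" "perm_word E" "perm_word v"
  shows "contains_pattern (skew_square A E) (skew_square v []) \<longleftrightarrow>
    contains_pattern A v \<or> contains_pattern E (skew_square v [])"
proof -
  let ?w = "skew_square v []"
  let ?iv = "add_top (inverse_word v)" and ?iA = "add_top (inverse_word A)"
  have w: "?w = add_top v \<ominus> ?iv" by (simp add: skew_square_def)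
  have p': "perm_word (add_top v)" "perm_word ?iv" "perm_word (add_top A)" "perm_word ?iA" "perm_word (E \<ominus> ?iA)"
    using p by (simp_all add: perm_word_skew_sum perm_word_add_top perm_word_inverse_word)
  have ind: "skew_indecomposable (add_top v)" "skew_indecomposable ?iv"
    using p by (simp_all add: skew_indecomposable_add_top perm_word_inverse_word)
  have A: "contains_pattern (add_top A) (add_top v) \<longleftrightarrow> contains_pattern A v"
    "contains_pattern ?iA ?iv \<longleftrightarrow> contains_pattern A v"
    using p contains_add_top_add_top contains_inverse_word_iff perm_word_inverse_word by simp_all
  have "contains_pattern A v" if "contains_pattern (add_top A) ?w"
    using contains_skew_sumD(1) that A(1) unfolding w by blast
  moreover have "contains_pattern A v" if "contains_pattern ?iA ?w"
    using contains_skew_sumD(2) that A(2) unfolding w by blast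
  moreover have "contains_pattern (skew_square A E) ?w \<longleftrightarrow>
    contains_pattern (add_top A) ?w \<or> contains_pattern (E \<ominus> ?iA) ?w \<or>
    contains_pattern (add_top A) (add_top v) \<and> contains_pattern (E \<ominus> ?iA) ?iv"
    unfolding skew_square_def[of A E] w by (rule contains_skew_sum_skew_sum) (use p' ind in auto)
  moreover have "contains_pattern (E \<ominus> ?iA) ?w \<longleftrightarrow> contains_pattern E ?w \<or> contains_pattern ?iA ?w \<or>
      contains_pattern E (add_top v) \<and> contains_pattern ?iA ?iv"
    unfolding w by (rule contains_skew_sum_skew_sum) (use p p' ind in auto)
  moreover have "contains_pattern (E \<ominus> ?iA) ?iv" if "contains_pattern ?iA ?iv"
    using that contains_skew_sumI(2) by blast
  ultimately show ?thesis using A by blast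
qed

text \<open>The pattern ends in |v| + 1, below its maximum 2|v| + 2, so a new top element cannot
  take part.\<close>

lemma contains_add_top_skew_square:
  assumes "perm_word A"
  shows "contains_pattern (add_top A) (skew_square v []) \<longleftrightarrow> contains_pattern A (skew_square v [])"
  by (rule contains_add_top_iff[OF assms, of "2 * length v + 2"])
    (simp_all add: skew_square_def skew_sum_def add_top_def)

lemma involution_gf_skew_square:
  assumes "perm_word v"
  shows "involution_gf (skew_square v []) = 1 + fps_X * involution_gf (skew_square v []) +
    fps_X\<^sup>2 * (word_gf v oo fps_X\<^sup>2) * involution_gf (skew_square v [])"
proof (rule involution_gf_step)
  show "skew_square v [] \<noteq> []" by (simp add: skew_square_def skew_sum_def add_top_def)
qed (simp_all add: contains_add_top_skew_square contains_skew_square_skew_square assms)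

section \<open>Involutions avoiding an increasing pattern\<close>

text \<open>An increasing pattern has no skew cut, so it occurs within one block. It is its own
  inverse, so both outer blocks impose the same condition on A.\<close>

lemma contains_skew_square_upt:
  assumes p: "perm_word A" "perm_word E"
  shows "contains_pattern (skew_square A E) [1..<Suc (Suc m)] \<longleftrightarrow>
    contains_pattern A [1..<Suc m] \<or> contains_pattern E [1..<Suc (Suc m)]"
proof -
  let ?T = "[1..<Suc (Suc m)]"
  have T: "skew_indecomposable ?T"
    unfolding upt_eq_add_top by (rule skew_indecomposable_add_top[OF perm_word_upt])
  have "contains_pattern (add_top B) ?T \<longleftrightarrow> contains_pattern B [1..<Suc m]" if "perm_word B" for B
    unfolding upt_eq_add_top by (rule contains_add_top_add_top[OF that perm_word_upt])
  moreover have "contains_pattern (inverse_word A) [1..<Suc m] \<longleftrightarrow> contains_pattern A [1..<Suc m]"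
    using contains_inverse_word_iff[OF p(1) perm_word_upt[of m]] unfolding inverse_word_upt .
  ultimately show ?thesis
    unfolding skew_square_def using p T
    by (auto simp only: contains_skew_sum_indecomposable perm_word_skew_sum perm_word_add_top perm_word_inverse_word)
qed

lemma involution_gf_upt:
  "involution_gf [1..<Suc (Suc m)] = 1 + fps_X * involution_gf [1..<Suc m] +
    fps_X\<^sup>2 * (word_gf [1..<Suc m] oo fps_X\<^sup>2) * involution_gf [1..<Suc (Suc m)]"
proof (rule involution_gf_step)
  show "contains_pattern (add_top A) [1..<Suc (Suc m)] \<longleftrightarrow> contains_pattern A [1..<Suc m]"
    if "perm_word A" for A
    unfolding upt_eq_add_top by (rule contains_add_top_add_top[OF that perm_word_upt])
qed (simp, rule contains_skew_square_upt)

lemma involution_gf_Nil: "involution_gf [] = 0"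
  by (rule fps_ext) (simp add: involution_gf_def avoiding_involutions_def avoids_pattern_def)

section \<open>Solving the equations for the involution series\<close>

definition den2 :: "nat \<Rightarrow> real fps" where
  "den2 k = cheb_den k oo fps_X\<^sup>2"

definition num2 :: "nat \<Rightarrow> real fps" where
  "num2 k = cheb_num k oo fps_X\<^sup>2"

lemma den2_add: "den2 (a + b) = den2 a * den2 b - fps_X\<^sup>2 * num2 a * num2 b"
  by (simp add: den2_def num2_def cheb_den_add fps_compose_sub_distrib fps_compose_mult_distrib)

lemma den2_Suc: "den2 (Suc k) = den2 k - fps_X\<^sup>2 * num2 k"
  by (simp add: den2_def num2_def cheb_den_Suc fps_compose_sub_distrib fps_compose_mult_distrib)

lemma num2_Suc: "num2 (Suc k) = den2 k"
  by (simp add: den2_def num2_def)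

lemma den2_num2_0: "den2 0 = 1" "num2 0 = 0"
  by (simp_all add: den2_def num2_def)

lemma den2_nth_0: "den2 k $ 0 = 1"
  by (simp add: den2_def)

lemma word_gf_compose:
  "word_gf w * cheb_den k = cheb_num k \<Longrightarrow> (word_gf w oo fps_X\<^sup>2) * den2 k = num2 k"
  by (simp add: den2_def num2_def flip: fps_compose_mult_distrib)

text \<open>Multiplying I_m by P_m(x^2) removes the denominators: J_m = I_m P_m(x^2) satisfies
  J_(m+1) = P_m(x^2) + x J_m.\<close>

lemma involution_gf_upt_mult:
  "involution_gf [1..<Suc (Suc m)] * den2 (Suc m) = den2 m + fps_X * (involution_gf [1..<Suc m] * den2 m)"
proof -
  have "I * (P - x\<^sup>2 * Q) = P + x * (J * P)" if "I = 1 + x * J + x\<^sup>2 * F * I" "F * P = Q"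
    for I P x Q J F :: "real fps"
    using that by algebra
  from this[OF involution_gf_upt word_gf_compose[OF word_gf_upt]] show ?thesis by (simp only: den2_Suc)
qed

text \<open>Two steps of the recursion for J_m. Splitting 2l + 1 as (l + 1) + l and 2l as l + l
  leaves only P_(l+1), P_l and P_(l-1), and the terms with P_(l-1) cancel.\<close>

lemma involution_gf_upt_even:
  "involution_gf [1..<Suc (2 * l)] * den2 (2 * l) = num2 l * (den2 l + fps_X * num2 l)"
proof (induction l)
  case 0
  show ?case by (simp add: involution_gf_Nil den2_num2_0)
next
  case (Suc l)
  have "involution_gf [1..<Suc (2 * Suc l)] * den2 (2 * Suc l) =
      den2 (Suc (2 * l)) + fps_X * (den2 (2 * l) + fps_X * (involution_gf [1..<Suc (2 * l)] * den2 (2 * l)))"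
    by (simp only: involution_gf_upt_mult mult_Suc_right add_2_eq_Suc)
  also have "\<dots> = den2 (Suc l + l) + fps_X * (den2 (l + l) + fps_X * (num2 l * (den2 l + fps_X * num2 l)))"
    by (subst Suc.IH) (simp only: mult_2 add_Suc)
  also have "\<dots> = num2 (Suc l) * (den2 (Suc l) + fps_X * num2 (Suc l))"
    unfolding den2_add num2_Suc by (simp add: algebra_simps power2_eq_square)
  finally show ?case .
qed

text \<open>The common last step: both kinds of patterns lead to this linear equation, and P_l(x^2)
  can be cancelled because its constant term is 1.\<close>

lemma eq_chebyshev_quotient:
  assumes l: "1 \<le> l" and I: "I * (den2 l - fps_X * num2 l) = num2 l"
  shows "I = (chebyshev_R l oo fps_X\<^sup>2) / (1 - fps_X * (chebyshev_R l oo fps_X\<^sup>2))"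
proof -
  define R where "R = chebyshev_R l oo fps_X\<^sup>2"
  have R: "R * den2 l = num2 l"
    using chebyshev_R_mult[OF l] by (simp add: R_def den2_def num2_def flip: fps_compose_mult_distrib)
  have "(I * (1 - fps_X * R)) * den2 l = R * den2 l"
    using I by (simp add: algebra_simps flip: R)
  moreover have "den2 l \<noteq> 0" using den2_nth_0[of l] by auto
  ultimately have "I * (1 - fps_X * R) = R" by simp
  moreover have "(1 - fps_X * R) $ 0 = 1" by simp
  then have "1 - fps_X * R \<noteq> 0" by (metis fps_zero_nth zero_neq_one)
  ultimately show ?thesis unfolding R_def[symmetric] by (metis nonzero_mult_div_cancel_right)
qed

lemma involution_gf_upt_eq:
  assumes "1 \<le> l"
  shows "involution_gf [1..<Suc (2 * l)] =
    (chebyshev_R l oo fps_X\<^sup>2) / (1 - fps_X * (chebyshev_R l oo fps_X\<^sup>2))"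
proof (rule eq_chebyshev_quotient[OF assms])
  let ?I = "involution_gf [1..<Suc (2 * l)]"
  have "den2 (2 * l) = (den2 l - fps_X * num2 l) * (den2 l + fps_X * num2 l)"
    unfolding mult_2 den2_add by (simp add: algebra_simps power2_eq_square)
  then have "?I * (den2 l - fps_X * num2 l) * (den2 l + fps_X * num2 l) = num2 l * (den2 l + fps_X * num2 l)"
    using involution_gf_upt_even[of l] by (simp only: mult.assoc)
  \<comment> \<open>This factor appears in the denominator P_(2l)(x^2) as well as in the closed form
    of J_(2l); being nonzero, it cancels.\<close>
  moreover have "(den2 l + fps_X * num2 l) $ 0 = 1" by (simp add: den2_nth_0)
  then have "den2 l + fps_X * num2 l \<noteq> 0" by (metis fps_zero_nth zero_neq_one)
  ultimately show "?I * (den2 l - fps_X * num2 l) = num2 l" by (metis mult_right_cancel)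
qed

lemma involution_gf_skew_square_eq:
  assumes v: "perm_word v" "word_gf v * cheb_den (length v) = cheb_num (length v)"
  defines "l \<equiv> Suc (length v)"
  shows "involution_gf (skew_square v []) =
    (chebyshev_R l oo fps_X\<^sup>2) / (1 - fps_X * (chebyshev_R l oo fps_X\<^sup>2))"
proof (rule eq_chebyshev_quotient)
  \<comment> \<open>Here P and Q are the values of P_(l-1) and P_(l-2) at x^2, with Q = 0 if l = 1.
    Then P - x^2 Q is P_l(x^2), and P is the numerator \<open>num2 l\<close>.\<close>
  have "I * (P - x\<^sup>2 * Q - x * P) = P" if "I = 1 + x * I + x\<^sup>2 * F * I" "F * P = Q"
    for I P x Q F :: "real fps"
    using that by algebra
  from this[OF involution_gf_skew_square[OF v(1)] word_gf_compose[OF v(2)]]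
  show "involution_gf (skew_square v []) * (den2 l - fps_X * num2 l) = num2 l"
    by (simp only: l_def den2_Suc num2_Suc)
qed (simp add: l_def)

text \<open>The first form takes for v the inverse of the wedge pattern, the second the wedge
  pattern itself. As |v| = l - 1, the tops of the two blocks are 2l and l, and the shift of the
  first block is l.\<close>

lemma double_wedge_pattern_skew_square:
  assumes "2 \<le> l" "double_wedge_pattern l \<tau>"
  obtains v where "perm_word v" "length v = l - 1" "one_line (2 * l) \<tau> = skew_square v []"
    "iterated_wedge v \<or> iterated_wedge (inverse_word v)"
proof -
  obtain \<sigma> where \<sigma>: "\<sigma> permutes {1..l - 1}" and wedge: "iterated_wedge (one_line (l - 1) \<sigma>)"
    and \<tau>: "one_line (2 * l) \<tau> =
        map (\<lambda>x. x + l) (one_line (l - 1) (inv \<sigma>)) @ [2 * l] @ one_line (l - 1) \<sigma> @ [l] \<or>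
      one_line (2 * l) \<tau> =
        map (\<lambda>x. x + l) (one_line (l - 1) \<sigma>) @ [2 * l] @ one_line (l - 1) (inv \<sigma>) @ [l]"
    using assms(2) unfolding double_wedge_pattern_def wedge_pattern_def
    by (blast dest: iterated_wedge_wedge_word)
  define u where "u = one_line (l - 1) \<sigma>"
  have u: "perm_word u" "length u = l - 1" "iterated_wedge u" "one_line (l - 1) (inv \<sigma>) = inverse_word u"
    using perm_word_one_line[OF \<sigma>] inverse_word_one_line[OF \<sigma>] wedge by (simp_all add: u_def)
  have sq: "skew_square v [] = map (\<lambda>x. x + l) v @ [2 * l] @ inverse_word v @ [l]"
    if "length v = l - 1" for v
    using assms(1) that by (simp add: skew_square_def skew_sum_def add_top_def)
  from \<tau> show thesis
  proof
    assume "one_line (2 * l) \<tau> =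
        map (\<lambda>x. x + l) (one_line (l - 1) (inv \<sigma>)) @ [2 * l] @ one_line (l - 1) \<sigma> @ [l]"
    then have "one_line (2 * l) \<tau> = skew_square (inverse_word u) []"
      using u(1,2) sq[of "inverse_word u"] unfolding u(4) u_def[symmetric] by simp
    then show thesis using that[of "inverse_word u"] u(1-3) by (simp add: perm_word_inverse_word)
  next
    assume "one_line (2 * l) \<tau> =
        map (\<lambda>x. x + l) (one_line (l - 1) \<sigma>) @ [2 * l] @ one_line (l - 1) (inv \<sigma>) @ [l]"
    then have "one_line (2 * l) \<tau> = skew_square u []"
      using u(2) sq[of u] unfolding u(4) u_def[symmetric] by simp
    then show thesis using that[of u] u(1-3) by simp
  qed
qed

theorem theorem2p15:
  fixes l :: nat and \<tau> :: "nat \<Rightarrow> nat"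
  assumes "2 \<le> l"
    and "double_wedge_pattern l \<tau>"
    and "avoids_pattern (one_line (2 * l) \<tau>) [1, 3, 2]"
  shows "involution_gf (one_line (2 * l) \<tau>) = involution_gf [1..<Suc (2 * l)] \<and>
    involution_gf [1..<Suc (2 * l)] =
      (chebyshev_R l oo fps_X\<^sup>2) / (1 - fps_X * (chebyshev_R l oo fps_X\<^sup>2))"
proof -
  obtain v where v: "perm_word v" "length v = l - 1" "one_line (2 * l) \<tau> = skew_square v []"
    and wedge: "iterated_wedge v \<or> iterated_wedge (inverse_word v)"
    by (rule double_wedge_pattern_skew_square[OF assms(1,2)])
  have "word_gf v * cheb_den (length v) = cheb_num (length v)"
    using wedge
  proof
    assume "iterated_wedge (inverse_word v)"
    from word_gf_iterated_wedge[OF this] show ?thesis by (simp add: word_gf_inverse_word[OF v(1)])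
  qed (rule word_gf_iterated_wedge)
  from involution_gf_skew_square_eq[OF v(1) this] show ?thesis
    using involution_gf_upt_eq[of l] v(2,3) assms(1) by simp
qed

end
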